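(* For every $n\in\mathbb N$, $H^{n+}$ is not universal; that is, there is a ceer $R$ with $R\not\leq H^{n+}$.
   Context: A ceer is an equivalence relation on $\mathbb N$ c.e. as a subset of $\mathbb N^2$; $R_1\leq R_2$ means there is a total computable $f$ with $xR_1y\Leftrightarrow f(x)R_2f(y)$. With $\varphi_e$ the standard enumeration of partial computable functions, $H$ is defined by $xHy\Leftrightarrow x=y\lor\varphi_x(x)\!\downarrow\,=\varphi_y(y)\!\downarrow$. The saturation jump $E^+$ of a ceer $E$ is the equivalence relation on finite subsets of $\mathbb N$ (identified with $\mathbb N$ via a fixed computable bijection) given by $xE^+y\Leftrightarrow [x]_E=[y]_E$, where $[X]_E=\{y:\exists x\in X\,(xEy)\}$; iterates are $E^{0+}=E$, $E^{(n+1)+}=(E^{n+})^+$. *)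

theory Defs
  imports Main "HOL-Library.Nat_Bijection"
begin

text \<open>
  Kleene's partial recursive functions. Terms carry no arity: a term denotes a partial function on
  argument lists of every length, and its restriction to lists of length \<open>k\<close> is a \<open>k\<close>-ary partial
  recursive function (nowhere defined if the list is too short for the term).
\<close>

datatype recf =
    Zero
  | Succ
  | Proj nat
  | Comp recf "recf list"
  | PrimRec recf recf
  | Mu recf

fun eval :: "recf \<Rightarrow> nat list \<Rightarrow> nat option" where
  "eval Zero xs = Some 0"
| "eval Succ xs = (case xs of [] \<Rightarrow> None | x # _ \<Rightarrow> Some (Suc x))"
| "eval (Proj i) xs = (if i < length xs then Some (xs ! i) else None)"
| "eval (Comp f gs) xs =
     (if \<forall>g\<in>set gs. eval g xs \<noteq> None then eval f (map (\<lambda>g. the (eval g xs)) gs) else None)"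
| "eval (PrimRec f g) xs =
     (case xs of
        [] \<Rightarrow> None
      | n # ys \<Rightarrow>
          rec_nat (eval f ys)
            (\<lambda>k r. case r of None \<Rightarrow> None | Some v \<Rightarrow> eval g (k # v # ys)) n)"
| "eval (Mu f) xs =
     (if \<exists>n. eval f (n # xs) = Some 0 \<and> (\<forall>m<n. eval f (m # xs) \<noteq> None)
      then Some (LEAST n. eval f (n # xs) = Some 0) else None)"

text \<open>The Goedel numbering of terms; it is a bijection between codes and terms.\<close>

lemma prod_decode_le: "prod_decode n = (a, b) \<Longrightarrow> a \<le> n \<and> b \<le> n"
  by (metis le_prod_encode_1 le_prod_encode_2 prod_decode_inverse)

lemma list_decode_le: "x \<in> set (list_decode n) \<Longrightarrow> x \<le> n"
proof (induction n rule: list_decode.induct)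
  case 1
  then show ?case by simp
next
  case (2 n)
  obtain a b where ab: "prod_decode n = (a, b)" by fastforce
  with 2 prod_decode_le[OF ab] show ?case by fastforce
qed

function decode :: "nat \<Rightarrow> recf" where
  "decode 0 = Zero"
| "decode (Suc 0) = Succ"
| "decode (Suc (Suc m)) =
     (let q = m div 4; r = m mod 4; a = fst (prod_decode q); b = snd (prod_decode q) in
      if r = 0 then Proj q
      else if r = 1 then Comp (decode a) (map decode (list_decode b))
      else if r = 2 then PrimRec (decode a) (decode b)
      else Mu (decode q))"
  by pat_completeness auto
termination
proof (relation "measure id", goal_cases)
  case (2 m q r a b)
  with prod_decode_le[of q a b] have "a \<le> m div 4" by simp
  then show ?case by simp
next
  case (3 m q r a b z)
  with prod_decode_le[of q a b] have "b \<le> m div 4" by simp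
  with 3 list_decode_le[of z b] show ?case by simp
next
  case (4 m q r a b)
  with prod_decode_le[of q a b] have "a \<le> m div 4" by simp
  then show ?case by simp
next
  case (5 m q r a b)
  with prod_decode_le[of q a b] have "b \<le> m div 4" by simp
  then show ?case by simp
qed auto

fun encode :: "recf \<Rightarrow> nat" where
  "encode Zero = 0"
| "encode Succ = 1"
| "encode (Proj i) = 4 * i + 2"
| "encode (Comp f gs) = 4 * prod_encode (encode f, list_encode (map encode gs)) + 3"
| "encode (PrimRec f g) = 4 * prod_encode (encode f, encode g) + 4"
| "encode (Mu f) = 4 * encode f + 5"

lemma decode_step:
  "decode (4 * q + 2) = Proj q"
  "decode (4 * prod_encode (a, b) + 3) = Comp (decode a) (map decode (list_decode b))"
  "decode (4 * prod_encode (a, b) + 4) = PrimRec (decode a) (decode b)"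
  "decode (4 * q + 5) = Mu (decode q)"
proof -
  have *: "(4 * q + 0) div 4 = q" "(4 * q + 0) mod 4 = 0" "(4 * q + 1) div 4 = q"
      "(4 * q + 1) mod 4 = 1" "(4 * q + 2) div 4 = q" "(4 * q + 2) mod 4 = 2"
      "(4 * q + 3) div 4 = q" "(4 * q + 3) mod 4 = 3" for q :: nat
    by presburger+
  have "decode (4 * q + 2) = decode (Suc (Suc (4 * q + 0)))"
    by (rule arg_cong[of _ _ decode]) simp
  then show "decode (4 * q + 2) = Proj q"
    unfolding decode.simps(3) Let_def * by simp
  have "decode (4 * prod_encode (a, b) + 3) = decode (Suc (Suc (4 * prod_encode (a, b) + 1)))"
    by (rule arg_cong[of _ _ decode]) simp
  then show "decode (4 * prod_encode (a, b) + 3) = Comp (decode a) (map decode (list_decode b))"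
    unfolding decode.simps(3) Let_def * by simp
  have "decode (4 * prod_encode (a, b) + 4) = decode (Suc (Suc (4 * prod_encode (a, b) + 2)))"
    by (rule arg_cong[of _ _ decode]) simp
  then show "decode (4 * prod_encode (a, b) + 4) = PrimRec (decode a) (decode b)"
    unfolding decode.simps(3) Let_def * by simp
  have "decode (4 * q + 5) = decode (Suc (Suc (4 * q + 3)))"
    by (rule arg_cong[of _ _ decode]) simp
  then show "decode (4 * q + 5) = Mu (decode q)"
    unfolding decode.simps(3) Let_def * by simp
qed

declare decode.simps(3) [simp del]

lemma decode_encode: "decode (encode p) = p"
proof (induction p rule: encode.induct)
  case (4 f gs)
  have "map decode (map encode gs) = gs" using 4 by (simp add: map_idI)
  with 4 show ?case unfolding encode.simps decode_step list_encode_inverse by simp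
qed (simp_all only: encode.simps decode.simps(1,2) One_nat_def decode_step)

lemma encode_decode: "encode (decode n) = n"
proof (induction n rule: less_induct)
  case (less n)
  obtain a b where ab: "prod_decode ((n - 2) div 4) = (a, b)" by fastforce
  define q where "q = (n - 2) div 4"
  have q: "q = prod_encode (a, b)" using ab unfolding q_def by (metis prod_decode_inverse)
  have le: "a \<le> q" "b \<le> q" using prod_decode_le[OF ab] by (auto simp: q_def)
  consider "n = 0" | "n = 1" | "n \<ge> 2" by linarith
  then show ?case
  proof cases
    case 3
    then have qn: "q < n" unfolding q_def by linarith
    have IH: "encode (decode a) = a" "encode (decode b) = b" "encode (decode q) = q"
      using less.IH qn le by auto
    have l: "map encode (map decode (list_decode b)) = list_decode b"
      unfolding map_map
    proof (rule map_idI)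
      fix x assume "x \<in> set (list_decode b)"
      then have "x < n" using list_decode_le le qn by fastforce
      then show "(encode \<circ> decode) x = x" using less.IH by simp
    qed
    have "n = 4 * q + 2 \<or> n = 4 * q + 3 \<or> n = 4 * q + 4 \<or> n = 4 * q + 5"
      using 3 unfolding q_def by presburger
    then show ?thesis
    proof (elim disjE)
      assume "n = 4 * q + 2"
      then show ?thesis by (simp only: decode_step encode.simps)
    next
      assume "n = 4 * q + 3"
      then show ?thesis unfolding q
        by (simp only: decode_step encode.simps IH l list_decode_inverse)
    next
      assume "n = 4 * q + 4"
      then show ?thesis unfolding q by (simp only: decode_step encode.simps IH)
    next
      assume "n = 4 * q + 5"
      then show ?thesis by (simp only: decode_step encode.simps IH)
    qed
  qed simp_all
qed

lemma bij_decode: "bij decode"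
  by (rule o_bij[of encode]) (auto simp: fun_eq_iff decode_encode encode_decode)

definition phi :: "nat \<Rightarrow> nat \<Rightarrow> nat option" where
  "phi e x = eval (decode e) [x]"

definition total_computable :: "(nat \<Rightarrow> nat) \<Rightarrow> bool" where
  "total_computable f \<longleftrightarrow> (\<exists>e. \<forall>x. phi e x = Some (f x))"

definition ce2 :: "(nat \<times> nat) set \<Rightarrow> bool" where
  "ce2 R \<longleftrightarrow> (\<exists>p. R = {(x, y). eval p [x, y] \<noteq> None})"

definition ceer :: "(nat \<times> nat) set \<Rightarrow> bool" where
  "ceer R \<longleftrightarrow> equiv UNIV R \<and> ce2 R"

definition reducible :: "(nat \<times> nat) set \<Rightarrow> (nat \<times> nat) set \<Rightarrow> bool"  (infix "\<le>\<^sub>c" 50) where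
  "R \<le>\<^sub>c S \<longleftrightarrow> (\<exists>f. total_computable f \<and> (\<forall>x y. (x, y) \<in> R \<longleftrightarrow> (f x, f y) \<in> S))"

text \<open>
  That \<open>E\<close> is itself a ceer is not part of the definition, so non-universality always means that
  some ceer fails to reduce to \<open>E\<close>.
\<close>

definition universal :: "(nat \<times> nat) set \<Rightarrow> bool" where
  "universal E \<longleftrightarrow> (\<forall>R. ceer R \<longrightarrow> R \<le>\<^sub>c E)"

definition H_rel :: "(nat \<times> nat) set" where
  "H_rel = {(x, y). x = y \<or> (\<exists>v. phi x x = Some v \<and> phi y y = Some v)}"

text \<open>
  Finite sets are coded by canonical indices: \<^const>\<open>set_decode\<close> sends \<open>2^i\<^sub>1 + \<dots> + 2^i\<^sub>k\<close> (distinct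
  exponents) to \<open>{i\<^sub>1, \<dots>, i\<^sub>k}\<close>. The image \<open>E `` X\<close> is the \<open>E\<close>-saturation of \<open>X\<close>.
\<close>

definition sat_jump :: "(nat \<times> nat) set \<Rightarrow> (nat \<times> nat) set" where
  "sat_jump E = {(x, y). E `` set_decode x = E `` set_decode y}"

end

theory Submission
  imports Defs
begin

text \<open>
  An element of \<open>H\<^sup>n\<^sup>+\<close> is a hereditarily finite set of rank \<open>n\<close> over numbers. Two such sets can only
  become equivalent if every number \<open>a\<close> below one but not the other is determined, that is,
  \<open>\<phi>\<^sub>a(a)\<close> has converged; and no pair becomes equivalent without some number below it becoming
  determined. To defeat a candidate reduction, with \<open>F i\<close> its value at the \<open>i\<close>-th element of a
  column of \<open>R\<close>, choose by a Ramsey argument elements \<open>0, m, p\<^sub>1, q\<^sub>1, p\<^sub>2, q\<^sub>2, \<dots>\<close> of the column such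
  that any two of the \<open>F p\<^sub>i\<close>, \<open>F q\<^sub>i\<close> only share numbers that occur in \<open>F m\<close>. Merging \<open>0\<close> with \<open>m\<close> and each
  \<open>p\<^sub>i\<close> with \<open>q\<^sub>i\<close> forces all numbers involved to be determined, except those in \<open>F 0\<close>, which are at
  most the code \<open>F 0\<close>. The resulting classes are then merged one at a time, each time waiting until a
  finite stage of the jump realises exactly the current partition. Every such step determines a new
  number \<open>\<le> F 0\<close>, so \<open>F 0 + 3\<close> classes are too many.
\<close>

section \<open>Closure properties of the total computable functions\<close>

lemma total_computable_iff: "total_computable f \<longleftrightarrow> (\<exists>p. \<forall>x. eval p [x] = Some (f x))"
  unfolding total_computable_def phi_def by (metis decode_encode)

section \<open>Cantor pairing and its inverse as recursive functions\<close>

definition pair :: "nat \<Rightarrow> nat \<Rightarrow> nat" where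
  "pair a b = prod_encode (a, b)"

definition pi1 :: "nat \<Rightarrow> nat" where
  "pi1 z = fst (prod_decode z)"

definition pi2 :: "nat \<Rightarrow> nat" where
  "pi2 z = snd (prod_decode z)"

lemma pi1_pair [simp]: "pi1 (pair a b) = a"
  and pi2_pair [simp]: "pi2 (pair a b) = b"
  and pair_pi [simp]: "pair (pi1 z) (pi2 z) = z"
  by (simp_all add: pair_def pi1_def pi2_def)

lemma pair_eq_iff [simp]: "pair a b = pair c d \<longleftrightarrow> a = c \<and> b = d"
  by (simp add: pair_def)

lemma le_pair: "a \<le> pair a b" "b \<le> pair a b"
  by (simp_all add: pair_def le_prod_encode_1 le_prod_encode_2)

lemma pi_le: "pi1 z \<le> z" "pi2 z \<le> z"
  using le_pair(1)[of "pi1 z" "pi2 z"] le_pair(2)[of "pi2 z" "pi1 z"] by simp_all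

definition add_rf :: recf where
  "add_rf = PrimRec (Proj 0) (Comp Succ [Proj 1])"

definition mult_rf :: recf where
  "mult_rf = PrimRec Zero (Comp add_rf [Proj 1, Proj 2])"

text \<open>\<open>PrimRec\<close> recurses on its first argument, hence the swapped projections.
  The inner \<open>PrimRec Zero (Proj 0)\<close> is the predecessor.\<close>

definition diff_rf :: recf where
  "diff_rf = Comp (PrimRec (Proj 0) (Comp (PrimRec Zero (Proj 0)) [Proj 1])) [Proj 1, Proj 0]"

definition triangle_rf :: recf where
  "triangle_rf = PrimRec Zero (Comp add_rf [Comp Succ [Proj 0], Proj 1])"

definition pair_rf :: recf where
  "pair_rf = Comp add_rf [Comp triangle_rf [Comp add_rf [Proj 0, Proj 1]], Proj 0]"

lemma eval_add_rf [simp]: "eval add_rf [m, n] = Some (m + n)"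
  unfolding add_rf_def by (induction m) auto

lemma eval_mult_rf [simp]: "eval mult_rf [m, n] = Some (m * n)"
  unfolding mult_rf_def by (induction m) (auto simp: add.commute)

lemma eval_diff_rf [simp]: "eval diff_rf [m, n] = Some (m - n)"
proof -
  have pred: "eval (PrimRec Zero (Proj 0)) [k] = Some (k - 1)" for k
  proof -
    have "eval (PrimRec Zero (Proj 0)) [Suc j] = Some j" for j
      by (induction j) auto
    then show ?thesis by (cases k) auto
  qed
  have "eval (PrimRec (Proj 0) (Comp (PrimRec Zero (Proj 0)) [Proj 1])) [n, m] = Some (m - n)"
    using pred by (induction n) auto
  then show ?thesis unfolding diff_rf_def by simp
qed

lemma eval_triangle_rf [simp]: "eval triangle_rf [n] = Some (triangle n)"
  unfolding triangle_rf_def by (induction n) auto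

lemma eval_pair_rf [simp]: "eval pair_rf [a, b] = Some (pair a b)"
  unfolding pair_rf_def by (simp add: pair_def prod_encode_def)

text \<open>The largest d with \<open>triangle d\<close> \<le> n, which is the sum of the two
  components coded by n. The truncated differences add 1 exactly when the next triangular number has
  been reached.\<close>

primrec diagonal :: "nat \<Rightarrow> nat" where
  "diagonal 0 = 0"
| "diagonal (Suc n) = diagonal n + (1 - (triangle (Suc (diagonal n)) - Suc n))"

lemma diagonal_bounds: "triangle (diagonal n) \<le> n \<and> n < triangle (Suc (diagonal n))"
proof (induction n)
  case (Suc n)
  show ?case
  proof (cases "triangle (Suc (diagonal n)) \<le> Suc n")
    case True
    then have "diagonal (Suc n) = Suc (diagonal n)" by simp
    with True Suc show ?thesis by (simp only:) simp
  next
    case False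
    then have "diagonal (Suc n) = diagonal n" by simp
    with False Suc show ?thesis by (simp only:) simp
  qed
qed simp

text \<open>Consecutive triangular numbers bound disjoint intervals, and both sides index the
  interval that contains \<open>pair a b\<close>.\<close>

lemma diagonal_pair: "diagonal (pair a b) = a + b"
proof -
  have mono: "triangle (Suc m) \<le> triangle n" if "m < n" for m n
    using that by (induction n) (auto simp: less_Suc_eq)
  have "triangle (a + b) \<le> pair a b" "pair a b < triangle (Suc (a + b))"
    by (auto simp: pair_def prod_encode_def)
  moreover have "triangle (diagonal (pair a b)) \<le> pair a b"
    "pair a b < triangle (Suc (diagonal (pair a b)))"
    using diagonal_bounds by auto
  ultimately show ?thesis using mono by (meson leD le_less_trans less_le_trans linorder_neqE_nat)
qed

lemma pi1_eq: "pi1 z = z - triangle (diagonal z)"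
  and pi2_eq: "pi2 z = diagonal z - pi1 z"
proof -
  have "diagonal z = pi1 z + pi2 z" using diagonal_pair[of "pi1 z" "pi2 z"] by simp
  moreover have "z = triangle (pi1 z + pi2 z) + pi1 z"
    using pair_pi[of z] unfolding pair_def prod_encode_def by simp
  ultimately show "pi1 z = z - triangle (diagonal z)" "pi2 z = diagonal z - pi1 z" by auto
qed

definition diagonal_rf :: recf where
  "diagonal_rf = PrimRec Zero (Comp add_rf [Proj 1, Comp diff_rf [Comp Succ [Zero],
     Comp diff_rf [Comp triangle_rf [Comp Succ [Proj 1]], Comp Succ [Proj 0]]]])"

lemma eval_diagonal_rf [simp]: "eval diagonal_rf [n] = Some (diagonal n)"
  unfolding diagonal_rf_def by (induction n) auto

definition pi1_rf :: recf where
  "pi1_rf = Comp diff_rf [Proj 0, Comp triangle_rf [diagonal_rf]]"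

definition pi2_rf :: recf where
  "pi2_rf = Comp diff_rf [diagonal_rf, pi1_rf]"

lemma eval_pi_rf [simp]: "eval pi1_rf [z] = Some (pi1 z)" "eval pi2_rf [z] = Some (pi2 z)"
  unfolding pi2_rf_def by (simp_all add: pi1_rf_def pi1_eq pi2_eq)

section \<open>Closure rules for unary total computable functions\<close>

named_theorems tc

lemma tc_id [tc]: "total_computable (\<lambda>x. x)"
  unfolding total_computable_iff by (rule exI[of _ "Proj 0"]) simp

lemma tc_comp:
  assumes "total_computable g" "total_computable f"
  shows "total_computable (\<lambda>x. g (f x))"
proof -
  obtain p q where "\<forall>x. eval p [x] = Some (g x)" "\<forall>x. eval q [x] = Some (f x)"
    using assms unfolding total_computable_iff by blast
  then show ?thesis unfolding total_computable_iff by (intro exI[of _ "Comp p [q]"]) simp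
qed

lemma tc_comp2:
  assumes "\<And>a b. eval p [a, b] = Some (h a b)" "total_computable f" "total_computable g"
  shows "total_computable (\<lambda>x. h (f x) (g x))"
proof -
  obtain q r where "\<forall>x. eval q [x] = Some (f x)" "\<forall>x. eval r [x] = Some (g x)"
    using assms unfolding total_computable_iff by blast
  then show ?thesis
    unfolding total_computable_iff by (intro exI[of _ "Comp p [q, r]"]) (simp add: assms)
qed

lemmas tc_add [tc] = tc_comp2[OF eval_add_rf]
  and tc_mult [tc] = tc_comp2[OF eval_mult_rf]
  and tc_diff [tc] = tc_comp2[OF eval_diff_rf]
  and tc_pair [tc] = tc_comp2[OF eval_pair_rf]

lemma tc_Suc [tc]: "total_computable f \<Longrightarrow> total_computable (\<lambda>x. Suc (f x))"
  by (rule tc_comp[of Suc]) (auto simp: total_computable_iff intro!: exI[of _ Succ])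

lemma tc_const [tc]: "total_computable (\<lambda>x. n)"
proof (induction n)
  case 0
  show ?case unfolding total_computable_iff by (rule exI[of _ Zero]) simp
qed (rule tc_Suc)

lemma tc_pi1 [tc]: "total_computable f \<Longrightarrow> total_computable (\<lambda>x. pi1 (f x))"
  by (rule tc_comp[of pi1]) (auto simp: total_computable_iff intro!: exI[of _ pi1_rf])

lemma tc_pi2 [tc]: "total_computable f \<Longrightarrow> total_computable (\<lambda>x. pi2 (f x))"
  by (rule tc_comp[of pi2]) (auto simp: total_computable_iff intro!: exI[of _ pi2_rf])

text \<open>\<open>total_computable\<close> speaks of unary functions only, so the computability of
  the step \<open>h\<close> is expressed on coded triples of counter, previous value and
  parameter.\<close>

lemma tc_rec_nat:
  assumes a: "total_computable a"
    and h: "total_computable (\<lambda>z. h (pi1 z) (pi1 (pi2 z)) (pi2 (pi2 z)))"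
    and n: "total_computable n"
  shows "total_computable (\<lambda>x. rec_nat (a x) (\<lambda>k r. h k r x) (n x))"
proof -
  obtain pa ph pn where pa: "\<And>x. eval pa [x] = Some (a x)"
    and ph: "\<And>z. eval ph [z] = Some (h (pi1 z) (pi1 (pi2 z)) (pi2 (pi2 z)))"
    and pn: "\<And>x. eval pn [x] = Some (n x)"
    using assms unfolding total_computable_iff by blast
  define p where "p = PrimRec pa (Comp ph [Comp pair_rf [Proj 0, Comp pair_rf [Proj 1, Proj 2]]])"
  have "eval p [m, x] = Some (rec_nat (a x) (\<lambda>k r. h k r x) m)" for m x
    unfolding p_def by (induction m) (auto simp: pa ph)
  then have "eval (Comp p [pn, Proj 0]) [x] = Some (rec_nat (a x) (\<lambda>k r. h k r x) (n x))" for x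
    by (simp add: pn)
  then show ?thesis unfolding total_computable_iff by blast
qed

lemma tc_power [tc]:
  assumes "total_computable f" "total_computable g"
  shows "total_computable (\<lambda>x. f x ^ g x)"
proof -
  have "rec_nat 1 (\<lambda>k r. r * a) m = a ^ m" for a m :: nat
    by (induction m) auto
  then have "(\<lambda>x. f x ^ g x) = (\<lambda>x. rec_nat 1 (\<lambda>k r. r * f x) (g x))" by simp
  then show ?thesis
    by (simp only:) (intro tc_rec_nat[where h = "\<lambda>k r x. r * f x"] tc tc_comp[OF assms(1)] assms)
qed


subsection \<open>Decidable predicates\<close>

definition decidable :: "(nat \<Rightarrow> bool) \<Rightarrow> bool" where
  "decidable P \<longleftrightarrow> total_computable (\<lambda>x. of_bool (P x))"

lemma tc_of_bool [tc]: "decidable P \<Longrightarrow> total_computable (\<lambda>x. of_bool (P x))"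
  by (simp add: decidable_def)

lemma decidable_const [tc]: "decidable (\<lambda>x. b)"
  unfolding decidable_def by (rule tc_const)

lemma decidable_not [tc]:
  assumes "decidable P" shows "decidable (\<lambda>x. \<not> P x)"
proof -
  have "(\<lambda>x. of_bool (\<not> P x)) = (\<lambda>x. 1 - of_bool (P x) :: nat)" by (auto simp: fun_eq_iff)
  then show ?thesis unfolding decidable_def[of "\<lambda>x. \<not> P x"] by (simp only:) (intro tc assms)
qed

lemma decidable_conj [tc]: "decidable P \<Longrightarrow> decidable Q \<Longrightarrow> decidable (\<lambda>x. P x \<and> Q x)"
  unfolding decidable_def of_bool_conj by (intro tc) (simp_all add: decidable_def)

lemma decidable_disj [tc]:
  assumes "decidable P" "decidable Q" shows "decidable (\<lambda>x. P x \<or> Q x)"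
proof -
  have "(\<lambda>x. P x \<or> Q x) = (\<lambda>x. \<not> (\<not> P x \<and> \<not> Q x))" by simp
  then show ?thesis using assms by (simp only:) (intro tc)
qed

lemma decidable_imp [tc]:
  assumes "decidable P" "decidable Q" shows "decidable (\<lambda>x. P x \<longrightarrow> Q x)"
  unfolding imp_conv_disj by (intro tc assms)

lemma decidable_iff [tc]:
  assumes "decidable P" "decidable Q" shows "decidable (\<lambda>x. P x \<longleftrightarrow> Q x)"
  unfolding iff_conv_conj_imp by (intro tc assms)

lemma decidable_le [tc]:
  assumes "total_computable f" "total_computable g" shows "decidable (\<lambda>x. f x \<le> g x)"
proof -
  have "(\<lambda>x. of_bool (f x \<le> g x)) = (\<lambda>x. 1 - (f x - g x))" by (auto simp: fun_eq_iff)
  then show ?thesis unfolding decidable_def by (simp only:) (intro tc assms)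
qed

lemma decidable_less [tc]:
  assumes "total_computable f" "total_computable g" shows "decidable (\<lambda>x. f x < g x)"
  unfolding less_eq_Suc_le by (intro tc assms)

lemma decidable_eq [tc]:
  assumes "total_computable f" "total_computable g" shows "decidable (\<lambda>x. f x = g x)"
  unfolding order.eq_iff by (intro tc assms)

lemma decidable_comp: "decidable P \<Longrightarrow> total_computable f \<Longrightarrow> decidable (\<lambda>x. P (f x))"
  unfolding decidable_def by (rule tc_comp)

lemma tc_if [tc]:
  assumes "decidable P" "total_computable f" "total_computable g"
  shows "total_computable (\<lambda>x. if P x then f x else g x)"
proof -
  have "(\<lambda>x. if P x then f x else g x) = (\<lambda>x. of_bool (P x) * f x + of_bool (\<not> P x) * g x)"
    by auto
  then show ?thesis using assms by (simp only:) (intro tc)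
qed

lemma decidable_if [tc]:
  assumes "decidable P" "decidable Q" "decidable R"
  shows "decidable (\<lambda>x. if P x then Q x else R x)"
  unfolding if_bool_eq_conj by (intro tc assms)

text \<open>A bounded universal quantifier is a finite product of characteristic values, computed by
  primitive recursion.\<close>

lemma decidable_all_less [tc]:
  assumes P: "decidable (\<lambda>z. P (pi1 z) (pi2 z))" and n: "total_computable n"
  shows "decidable (\<lambda>x. \<forall>i<n x. P i x)"
proof -
  have "rec_nat 1 (\<lambda>k r. r * of_bool (P k x)) m = (of_bool (\<forall>i<m. P i x) :: nat)" for m x
    by (induction m) (auto simp: less_Suc_eq)
  then have *: "(\<lambda>x. of_bool (\<forall>i<n x. P i x) :: nat)
      = (\<lambda>x. rec_nat 1 (\<lambda>k r. r * of_bool (P k x)) (n x))" by simp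
  \<comment> \<open>The recursion step receives counter, accumulator and parameter as a coded
    triple; the predicate reads the first and the third.\<close>
  have d: "decidable (\<lambda>z. P (pi1 z) (pi2 (pi2 z)))"
    using decidable_comp[OF P, of "\<lambda>z. pair (pi1 z) (pi2 (pi2 z))"]
    by (simp add: tc_pair tc_pi1 tc_pi2 tc_id)
  show ?thesis
    unfolding decidable_def * by (intro tc_rec_nat[where h = "\<lambda>k r x. r * of_bool (P k x)"] tc n d)
qed

lemma decidable_ex_less [tc]:
  assumes "decidable (\<lambda>z. P (pi1 z) (pi2 z))" "total_computable n"
  shows "decidable (\<lambda>x. \<exists>i<n x. P i x)"
proof -
  have "(\<lambda>x. \<exists>i<n x. P i x) = (\<lambda>x. \<not> (\<forall>i<n x. \<not> P i x))" by simp
  then show ?thesis using assms by (simp only:) (intro tc)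
qed

lemma less_of_mem_set_decode: "a \<in> set_decode x \<Longrightarrow> a < x"
proof -
  assume "a \<in> set_decode x"
  then have "x div 2 ^ a \<noteq> 0" unfolding set_decode_def using odd_pos by fastforce
  then have "2 ^ a \<le> x" by (metis div_less not_le)
  then show "a < x" using less_exp[of a] by linarith
qed

text \<open>Membership says that the quotient by \<open>2 ^ a\<close> is odd. Naming quotient and
  remainder by bounded quantifiers leaves only sums, products and powers to compute.\<close>

lemma decidable_mem_set_decode [tc]:
  assumes "total_computable f" "total_computable g"
  shows "decidable (\<lambda>x. f x \<in> set_decode (g x))"
proof -
  have "a \<in> set_decode y \<longleftrightarrow> (\<exists>q<Suc y. \<exists>r<2 ^ a. y = (2 * q + 1) * 2 ^ a + r)" for a y
  proof
    assume "a \<in> set_decode y"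
    then obtain q where q: "y div 2 ^ a = 2 * q + 1" unfolding set_decode_def by (auto elim: oddE)
    then have y: "y = (2 * q + 1) * 2 ^ a + y mod 2 ^ a" by (metis div_mult_mod_eq)
    have "q \<le> y div 2 ^ a" using q by simp
    then have "q < Suc y" by (meson div_le_dividend le_imp_less_Suc le_trans)
    moreover have "y mod 2 ^ a < 2 ^ a" by simp
    ultimately show "\<exists>q<Suc y. \<exists>r<2 ^ a. y = (2 * q + 1) * 2 ^ a + r" using y by blast
  next
    assume "\<exists>q<Suc y. \<exists>r<2 ^ a. y = (2 * q + 1) * 2 ^ a + r"
    then obtain q r where "r < 2 ^ a" "y = r + (2 * q + 1) * 2 ^ a" by auto
    then have "y div 2 ^ a = 2 * q + 1" by (simp only: div_mult_self1) simp
    then show "a \<in> set_decode y" by (simp add: set_decode_def)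
  qed
  then show ?thesis by (simp only:) (intro tc assms tc_comp[OF assms(1)] tc_comp[OF assms(2)])
qed

lemma decidable_ball_set_decode [tc]:
  assumes "decidable (\<lambda>z. P (pi1 z) (pi2 z))" "total_computable f"
  shows "decidable (\<lambda>x. \<forall>a\<in>set_decode (f x). P a x)"
proof -
  have "(\<lambda>x. \<forall>a\<in>set_decode (f x). P a x) = (\<lambda>x. \<forall>a<f x. a \<in> set_decode (f x) \<longrightarrow> P a x)"
    using less_of_mem_set_decode by blast
  then show ?thesis by (simp only:) (intro tc assms tc_comp[OF assms(2)])
qed

lemma decidable_bex_set_decode [tc]:
  assumes "decidable (\<lambda>z. P (pi1 z) (pi2 z))" "total_computable f"
  shows "decidable (\<lambda>x. \<exists>a\<in>set_decode (f x). P a x)"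
proof -
  have "(\<lambda>x. \<exists>a\<in>set_decode (f x). P a x) = (\<lambda>x. \<not> (\<forall>a\<in>set_decode (f x). \<not> P a x))" by simp
  then show ?thesis using assms by (simp only:) (intro tc)
qed

lemma tc_div2 [tc]:
  assumes "total_computable f" shows "total_computable (\<lambda>x. f x div 2)"
proof -
  \<comment> \<open>Halving satisfies the recursion
    \<open>Suc k div 2 = k - k div 2\<close>.\<close>
  have "rec_nat 0 (\<lambda>k r. k - r) n = n div 2" for n :: nat
    by (induction n) auto
  then have "(\<lambda>x. f x div 2) = (\<lambda>x. rec_nat 0 (\<lambda>k r. k - r) (f x))" by simp
  then show ?thesis
    by (simp only:) (intro tc_rec_nat[where h = "\<lambda>k r x. k - r"] tc assms)
qed

text \<open>Unbounded search for a zero of the characteristic function of the negation. That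
  function is total, so the search halts exactly when a witness exists.\<close>

lemma ce2_projection:
  assumes "decidable (\<lambda>z. P (pi1 z) (pi1 (pi2 z)) (pi2 (pi2 z)))"
  shows "ce2 {(x, y). \<exists>w. P w x y}"
proof -
  have "total_computable (\<lambda>z. of_bool (\<not> P (pi1 z) (pi1 (pi2 z)) (pi2 (pi2 z))))"
    by (intro tc assms)
  then obtain p where
    p: "\<And>z. eval p [z] = Some (of_bool (\<not> P (pi1 z) (pi1 (pi2 z)) (pi2 (pi2 z))))"
    unfolding total_computable_iff by blast
  define q where "q = Mu (Comp p [Comp pair_rf [Proj 0, Comp pair_rf [Proj 1, Proj 2]]])"
  have "eval q [x, y] \<noteq> None \<longleftrightarrow> (\<exists>w. P w x y)" for x y
    unfolding q_def by (simp add: p)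
  then have "{(x, y). \<exists>w. P w x y} = {(x, y). eval q [x, y] \<noteq> None}" by blast
  then show ?thesis unfolding ce2_def by blast
qed

section \<open>A universal relation\<close>

definition consc :: "nat \<Rightarrow> nat \<Rightarrow> nat" where
  "consc x l = Suc (pair x l)"

definition hdc :: "nat \<Rightarrow> nat" where
  "hdc l = pi1 (l - 1)"

definition tlc :: "nat \<Rightarrow> nat" where
  "tlc l = pi2 (l - 1)"

definition dropc :: "nat \<Rightarrow> nat \<Rightarrow> nat" where
  "dropc i l = rec_nat l (\<lambda>k r. tlc r) i"

definition nthc :: "nat \<Rightarrow> nat \<Rightarrow> nat" where
  "nthc l i = hdc (dropc i l)"

text \<open>Counts the nonempty suffixes. The code itself serves as the number of rounds, because a
  list is never longer than its code.\<close>

definition lengthc :: "nat \<Rightarrow> nat" where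
  "lengthc l = rec_nat 0 (\<lambda>k r. r + of_bool (dropc k l \<noteq> 0)) l"

lemma tc_consc [tc]:
  "total_computable f \<Longrightarrow> total_computable g \<Longrightarrow> total_computable (\<lambda>x. consc (f x) (g x))"
  unfolding consc_def by (intro tc)

lemma tc_hdc [tc]: "total_computable f \<Longrightarrow> total_computable (\<lambda>x. hdc (f x))"
  unfolding hdc_def by (intro tc)

lemma tc_tlc [tc]: "total_computable f \<Longrightarrow> total_computable (\<lambda>x. tlc (f x))"
  unfolding tlc_def by (intro tc)

lemma tc_dropc [tc]:
  "total_computable f \<Longrightarrow> total_computable g \<Longrightarrow> total_computable (\<lambda>x. dropc (f x) (g x))"
  unfolding dropc_def by (intro tc_rec_nat[where h = "\<lambda>k r x. tlc r"] tc)

lemma tc_nthc [tc]: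
  "total_computable f \<Longrightarrow> total_computable g \<Longrightarrow> total_computable (\<lambda>x. nthc (f x) (g x))"
  unfolding nthc_def by (intro tc)

lemma tc_lengthc [tc]:
  assumes "total_computable f" shows "total_computable (\<lambda>x. lengthc (f x))"
  unfolding lengthc_def
  by (intro tc_rec_nat[where h = "\<lambda>k r x. r + of_bool (dropc k (f x) \<noteq> 0)"] tc assms
      tc_comp[OF assms])

lemma consc_list_encode [simp]: "consc x (list_encode xs) = list_encode (x # xs)"
  by (simp add: consc_def pair_def)

lemma hdc_consc [simp]: "hdc (consc x l) = x" and tlc_consc [simp]: "tlc (consc x l) = l"
  by (simp_all add: hdc_def tlc_def consc_def)

lemma consc_neq_0 [simp]: "0 < consc x l"
  by (simp add: consc_def)

lemma list_decode_consc [simp]: "list_decode (consc x l) = x # list_decode l"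
  by (metis consc_list_encode list_decode_inverse list_encode_inverse)

lemma tlc_list_encode: "tlc (list_encode xs) = list_encode (tl xs)"
proof (cases xs)
  case Nil
  then show ?thesis using pi_le(2)[of 0] by (simp add: tlc_def)
next
  case (Cons x ys)
  then show ?thesis by (metis consc_list_encode list.sel(3) tlc_consc)
qed

lemma dropc_list_encode: "dropc i (list_encode xs) = list_encode (drop i xs)"
  unfolding dropc_def by (induction i) (auto simp: tlc_list_encode drop_Suc tl_drop)

lemma list_encode_eq_0 [simp]: "list_encode xs = 0 \<longleftrightarrow> xs = []"
  by (cases xs) auto

lemma nthc_list_encode: "i < length xs \<Longrightarrow> nthc (list_encode xs) i = xs ! i"
  unfolding nthc_def dropc_list_encode
  by (metis Cons_nth_drop_Suc consc_list_encode hdc_consc)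

lemma length_le_list_encode: "length xs \<le> list_encode xs"
proof (induction xs)
  case (Cons x xs)
  then show ?case using le_prod_encode_2[of "list_encode xs" x] by simp
qed simp

lemma lengthc_list_encode: "lengthc (list_encode xs) = length xs"
proof -
  have "rec_nat 0 (\<lambda>k r. r + of_bool (dropc k (list_encode xs) \<noteq> 0)) n = min n (length xs)" for n
    by (induction n) (auto simp: dropc_list_encode)
  then show ?thesis
    unfolding lengthc_def using length_le_list_encode[of xs] by simp
qed

declare list_encode.simps(2) [simp del]

text \<open>Serves to show that a configuration with code \<open>L\<close> consults a column only at
  arguments up to \<open>L\<close>, so that a finite table of values decides everything about
  it.\<close>

lemma nthc_le: "nthc l i \<le> l"
proof -
  have "dropc i l \<le> l"
    unfolding dropc_def by (induction i) (auto simp: tlc_def intro: le_trans[OF pi_le(2)])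
  then show ?thesis
    unfolding nthc_def hdc_def using pi_le(1)[of "dropc i l - 1"] by linarith
qed

lemma ex_nthc: "\<exists>l. \<forall>i<n. nthc l i = h i"
  by (rule exI[of _ "list_encode (map h [0..<n])"]) (simp add: nthc_list_encode)

text \<open>
  A set \<open>S\<close> of coded triples \<open>(code, argument list, value)\<close> is a certificate when each of its
  triples follows from others in \<open>S\<close> by one clause of the definition of \<^const>\<open>eval\<close>. No order on
  the triples has to be recorded, since every clause refers to smaller codes or, for primitive
  recursion, to a smaller first argument.
\<close>

definition trip :: "nat \<Rightarrow> nat \<Rightarrow> nat \<Rightarrow> nat" where
  "trip e l v = pair e (pair l v)"

definition justified :: "nat set \<Rightarrow> nat \<Rightarrow> nat \<Rightarrow> nat \<Rightarrow> bool" where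
  "justified S e l v \<longleftrightarrow>
     (e = 0 \<and> v = 0) \<or>
     (e = 1 \<and> l \<noteq> 0 \<and> v = Suc (hdc l)) \<or>
     (\<exists>i<e. e = 4 * i + 2 \<and> i < lengthc l \<and> v = nthc l i) \<or>
     (\<exists>a<e. \<exists>b<e. e = 4 * pair a b + 3 \<and>
        (\<exists>t\<in>S. t = trip a (pi1 (pi2 t)) v \<and> lengthc (pi1 (pi2 t)) = lengthc b \<and>
           (\<forall>i<lengthc b. trip (nthc b i) l (nthc (pi1 (pi2 t)) i) \<in> S))) \<or>
     (\<exists>a<e. \<exists>b<e. e = 4 * pair a b + 4 \<and> l \<noteq> 0 \<and>
        (if hdc l = 0 then trip a (tlc l) v \<in> S
         else \<exists>t\<in>S. t = trip e (consc (hdc l - 1) (tlc l)) (pi2 (pi2 t)) \<and>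
           trip b (consc (hdc l - 1) (consc (pi2 (pi2 t)) (tlc l))) v \<in> S)) \<or>
     (\<exists>a<e. e = 4 * a + 5 \<and> trip a (consc v l) 0 \<in> S \<and>
        (\<forall>m<v. \<exists>t\<in>S. t = trip a (consc m l) (pi2 (pi2 t)) \<and> pi2 (pi2 t) \<noteq> 0))"

definition certificate :: "nat set \<Rightarrow> bool" where
  "certificate S \<longleftrightarrow> (\<forall>t\<in>S. justified S (pi1 t) (pi1 (pi2 t)) (pi2 (pi2 t)))"

lemma pi_trip [simp]: "pi1 (trip e l v) = e" "pi1 (pi2 (trip e l v)) = l" "pi2 (pi2 (trip e l v)) = v"
  by (simp_all add: trip_def)

lemma trip_eq_iff [simp]: "trip e l v = trip e' l' v' \<longleftrightarrow> e = e' \<and> l = l' \<and> v = v'"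
  by (simp add: trip_def)

lemma tc_trip [tc]:
  "total_computable f \<Longrightarrow> total_computable g \<Longrightarrow> total_computable h \<Longrightarrow>
    total_computable (\<lambda>x. trip (f x) (g x) (h x))"
  unfolding trip_def by (intro tc)

text \<open>Every quantifier in \<open>justified\<close> is bounded by a number or runs over
  \<open>S\<close>: intermediate argument lists and values are read off members \<open>t\<close> of
  \<open>S\<close> instead of being guessed.\<close>

lemma decidable_certificate [tc]:
  assumes "total_computable f"
  shows "decidable (\<lambda>x. certificate (set_decode (f x)))"
proof -
  have "decidable (\<lambda>c. certificate (set_decode c))"
    unfolding certificate_def justified_def by (intro tc)
  then show ?thesis by (rule decidable_comp[OF _ assms])
qed

section \<open>Soundness of certificates\<close>

lemma certificateD:
  "certificate S \<Longrightarrow> trip e l v \<in> S \<Longrightarrow> justified S e l v"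
  unfolding certificate_def by (metis pi_trip)

lemma certificateI:
  assumes "\<And>e l v. trip e l v \<in> S \<Longrightarrow> justified S e l v"
  shows "certificate S"
proof -
  have "t = trip (pi1 t) (pi1 (pi2 t)) (pi2 (pi2 t))" for t by (simp add: trip_def)
  then show ?thesis unfolding certificate_def using assms by metis
qed

text \<open>Strong induction on the code, since the premises of a justification have smaller codes.
  Primitive recursion may refer to its own code and needs an inner induction on the recursion
  argument.\<close>

lemma certificate_sound:
  assumes S: "certificate S"
  shows "trip e (list_encode xs) v \<in> S \<Longrightarrow> eval (decode e) xs = Some v"
proof (induction e arbitrary: xs v rule: less_induct)
  case (less e)
  let ?l = "list_encode xs"
  have IH: "eval (decode d) ys = Some u" if "d < e" "trip d (list_encode ys) u \<in> S" for d ys u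
    using less.IH that by blast
  from certificateD[OF S less.prems]
  consider (Zero) "e = 0" "v = 0"
    | (Succ) "e = 1" "?l \<noteq> 0" "v = Suc (hdc ?l)"
    | (Proj) i where "e = 4 * i + 2" "i < lengthc ?l" "v = nthc ?l i"
    | (Comp) a b t where "e = 4 * pair a b + 3" "t \<in> S" "t = trip a (pi1 (pi2 t)) v"
        "lengthc (pi1 (pi2 t)) = lengthc b"
        "\<forall>i<lengthc b. trip (nthc b i) ?l (nthc (pi1 (pi2 t)) i) \<in> S"
    | (PrimRec) a b where "e = 4 * pair a b + 4"
    | (Mu) a where "e = 4 * a + 5" "trip a (consc v ?l) 0 \<in> S"
        "\<forall>m<v. \<exists>t\<in>S. t = trip a (consc m ?l) (pi2 (pi2 t)) \<and> pi2 (pi2 t) \<noteq> 0"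
    unfolding justified_def by blast
  then show ?case
  proof cases
    case Zero
    then show ?thesis by simp
  next
    case Succ
    then obtain x ys where xs: "xs = x # ys" by (cases xs) auto
    then have "hdc ?l = x" by (metis consc_list_encode hdc_consc)
    then show ?thesis using Succ xs by simp
  next
    case Proj
    then show ?thesis
      by (simp only: decode_step lengthc_list_encode) (simp add: nthc_list_encode)
  next
    case (Comp a b t)
    define gs ys where "gs = list_decode b" and "ys = list_decode (pi1 (pi2 t))"
    have codes: "b = list_encode gs" "pi1 (pi2 t) = list_encode ys" by (simp_all add: gs_def ys_def)
    have e: "e = 4 * prod_encode (a, b) + 3" using Comp by (simp add: pair_def)
    have "a < e" using Comp(1) le_pair(1)[of a b] by linarith
    then have f: "eval (decode a) ys = Some v" using Comp(2,3) codes(2) IH by metis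
    have len: "length ys = length gs"
      using Comp(4) unfolding codes lengthc_list_encode .
    have g: "eval (decode (gs ! i)) xs = Some (ys ! i)" if "i < length gs" for i
    proof (rule IH)
      have "gs ! i \<le> b" using that list_decode_le[of "gs ! i" b] unfolding gs_def by simp
      then show "gs ! i < e" using Comp(1) le_pair(2)[of b a] by linarith
      show "trip (gs ! i) ?l (ys ! i) \<in> S"
        using Comp(5) that len unfolding codes lengthc_list_encode by (simp add: nthc_list_encode)
    qed
    have "map (\<lambda>g. the (eval g xs)) (map decode gs) = ys"
      using g len by (auto intro: nth_equalityI)
    moreover have "\<forall>h\<in>set (map decode gs). eval h xs \<noteq> None"
      using g by (fastforce simp: in_set_conv_nth)
    ultimately show ?thesis using f unfolding e decode_step gs_def[symmetric] by simp
  next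
    case (PrimRec a b)
    have lt: "a < e" "b < e" using PrimRec le_pair(1)[of a b] le_pair(2)[of b a] by linarith+
    have e: "e = 4 * prod_encode (a, b) + 4" using PrimRec by (simp add: pair_def)
    \<comment> \<open>A positive multiple of 4 fits only the clause for primitive recursion, which
      gives the inversion rule \<open>J\<close> for all triples with code \<open>e\<close>.\<close>
    have *: "e \<noteq> 0" "e \<noteq> 1" "e \<noteq> 4 * i + 2" "e \<noteq> 4 * i + 3" "e \<noteq> 4 * i + 5" for i
      using PrimRec by presburger+
    have J: "l \<noteq> 0 \<and> (if hdc l = 0 then trip a (tlc l) u \<in> S
         else \<exists>t\<in>S. t = trip e (consc (hdc l - 1) (tlc l)) (pi2 (pi2 t)) \<and>
           trip b (consc (hdc l - 1) (consc (pi2 (pi2 t)) (tlc l))) u \<in> S)"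
      if "trip e l u \<in> S" for l u
    proof -
      from certificateD[OF S that] * obtain a' b' where ab: "e = 4 * pair a' b' + 4"
        and H: "l \<noteq> 0 \<and> (if hdc l = 0 then trip a' (tlc l) u \<in> S
         else \<exists>t\<in>S. t = trip e (consc (hdc l - 1) (tlc l)) (pi2 (pi2 t)) \<and>
           trip b' (consc (hdc l - 1) (consc (pi2 (pi2 t)) (tlc l))) u \<in> S)"
        unfolding justified_def by blast
      have "a' = a" "b' = b" using ab PrimRec by auto
      show ?thesis using H unfolding \<open>a' = a\<close> \<open>b' = b\<close> .
    qed
    have "eval (decode e) (n # ys) = Some u" if "trip e (list_encode (n # ys)) u \<in> S" for n ys u
      using that
    proof (induction n arbitrary: u)
      case 0
      from J[OF 0] have "trip a (list_encode ys) u \<in> S"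
        unfolding consc_list_encode[symmetric] hdc_consc tlc_consc by simp
      then have "eval (decode a) ys = Some u" using IH lt by blast
      then show ?case unfolding e decode_step by simp
    next
      case (Suc n)
      from J[OF Suc.prems] obtain t where "t \<in> S" "t = trip e (list_encode (n # ys)) (pi2 (pi2 t))"
        "trip b (list_encode (n # pi2 (pi2 t) # ys)) u \<in> S"
        unfolding consc_list_encode[symmetric] hdc_consc tlc_consc by auto
      then obtain r where r: "trip e (list_encode (n # ys)) r \<in> S"
        "trip b (list_encode (n # r # ys)) u \<in> S" by metis
      then have "eval (decode e) (n # ys) = Some r" "eval (decode b) (n # r # ys) = Some u"
        using Suc.IH IH lt by blast+
      then show ?case unfolding e decode_step by simp
    qed
    moreover obtain n ys where "xs = n # ys"
      using J[OF less.prems] by (cases xs) auto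
    ultimately show ?thesis using less.prems by blast
  next
    case (Mu a)
    have "a < e" using Mu by simp
    then have 0: "eval (decode a) (v # xs) = Some 0"
      and pos: "\<And>m. m < v \<Longrightarrow> \<exists>u. eval (decode a) (m # xs) = Some u \<and> u \<noteq> 0"
      using Mu IH by (metis consc_list_encode)+
    then have "(LEAST n. eval (decode a) (n # xs) = Some 0) = v"
      by (intro Least_equality) (metis not_le option.inject)+
    moreover have "\<exists>n. eval (decode a) (n # xs) = Some 0 \<and> (\<forall>m<n. eval (decode a) (m # xs) \<noteq> None)"
      using 0 pos by force
    ultimately show ?thesis unfolding Mu decode_step by simp
  qed
qed

section \<open>Completeness of certificates\<close>

lemma justified_mono:
  assumes "S \<subseteq> S'" shows "justified S e l v \<longrightarrow> justified S' e l v"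
proof -
  have sub: "t \<in> S \<longrightarrow> t \<in> S'" for t using assms by blast
  show ?thesis
    unfolding justified_def Bex_def if_bool_eq_conj
    by (intro disj_mono conj_mono ex_mono sub) (use sub in blast)+
qed

definition certified :: "nat \<Rightarrow> bool" where
  "certified t \<longleftrightarrow> (\<exists>S. finite S \<and> certificate S \<and> t \<in> S)"

text \<open>By monotonicity of \<open>justified\<close>, a union of certificates is again a
  certificate.\<close>

lemma certificate_for_finite:
  assumes "finite T" "\<And>t. t \<in> T \<Longrightarrow> certified t"
  shows "\<exists>S. finite S \<and> certificate S \<and> T \<subseteq> S"
proof -
  from assms(2) obtain C where C: "\<And>t. t \<in> T \<Longrightarrow> finite (C t) \<and> certificate (C t) \<and> t \<in> C t"
    unfolding certified_def by metis
  have "certificate (\<Union>(C ` T))"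
  proof (rule certificateI)
    fix e l v assume "trip e l v \<in> \<Union>(C ` T)"
    then obtain t where t: "t \<in> T" "trip e l v \<in> C t" by blast
    then have "justified (C t) e l v" using C certificateD by blast
    then show "justified (\<Union>(C ` T)) e l v" using justified_mono[of "C t" "\<Union>(C ` T)"] t(1) by blast
  qed
  moreover have "finite (\<Union>(C ` T))" "T \<subseteq> \<Union>(C ` T)" using assms(1) C by auto
  ultimately show ?thesis by blast
qed

lemma certified_step:
  assumes "finite T" "\<And>t. t \<in> T \<Longrightarrow> certified t" "justified T e l v"
  shows "certified (trip e l v)"
proof -
  obtain S where S: "finite S" "certificate S" "T \<subseteq> S"
    using certificate_for_finite[OF assms(1,2)] by auto
  let ?S = "insert (trip e l v) S"
  have "certificate ?S"
  proof (rule certificateI)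
    fix e' l' v' assume "trip e' l' v' \<in> ?S"
    then have "(e' = e \<and> l' = l \<and> v' = v) \<or> trip e' l' v' \<in> S"
      unfolding insert_iff trip_eq_iff .
    then have "justified T e' l' v' \<or> justified S e' l' v'"
      using certificateD[OF S(2)] assms(3) by (elim disjE conjE) simp_all
    moreover have "S \<subseteq> ?S" "T \<subseteq> ?S" using S(3) by auto
    ultimately show "justified ?S e' l' v'" using justified_mono by blast
  qed
  moreover have "finite ?S" "trip e l v \<in> ?S" using S(1) by simp_all
  ultimately show ?thesis unfolding certified_def by blast
qed

lemma pair_lt_code: "a < 4 * pair a b + 3" "b < 4 * pair a b + 3"
    "a < 4 * pair a b + 4" "b < 4 * pair a b + 4"
  using le_pair(1)[of a b] le_pair(2)[of b a] by linarith+

text \<open>In each case a set \<open>T\<close> collects the triples of the subcomputations,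
  certified by induction, and one more step justifies the triple of the whole term. For
  \<open>PrimRec\<close> an inner induction follows the recursion argument.\<close>

lemma certified_eval:
  "eval p xs = Some v \<Longrightarrow> certified (trip (encode p) (list_encode xs) v)"
proof (induction p arbitrary: xs v)
  case Zero
  show ?case by (rule certified_step[of "{}"]) (use Zero in \<open>auto simp: justified_def\<close>)
next
  case Succ
  then obtain x ys where "xs = x # ys" "v = Suc x" by (auto split: list.splits)
  then show ?case
    by (intro certified_step[of "{}"])
      (auto simp: justified_def consc_list_encode[symmetric] simp del: consc_list_encode list_encode.simps)
next
  case (Proj i)
  then have "i < length xs" "v = xs ! i" by (auto split: if_splits)
  then have "justified {} (4 * i + 2) (list_encode xs) v"
    unfolding justified_def by (simp add: lengthc_list_encode nthc_list_encode)
  then show ?case using certified_step[of "{}"] by simp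
next
  case (Comp f gs)
  define ys where "ys = map (\<lambda>g. the (eval g xs)) gs"
  define b where "b = list_encode (map encode gs)"
  let ?l = "list_encode xs"
  have def: "\<forall>g\<in>set gs. eval g xs \<noteq> None" and f: "eval f ys = Some v"
    using Comp.prems by (auto simp: ys_def split: if_splits)
  define T where "T = insert (trip (encode f) (list_encode ys) v)
    ((\<lambda>i. trip (encode (gs ! i)) ?l (ys ! i)) ` {..<length gs})"
  have "justified T (4 * pair (encode f) b + 3) ?l v"
    unfolding justified_def
  proof (rule disjI2, rule disjI2, rule disjI2, rule disjI1,
      rule exI[of _ "encode f"], rule conjI[rotated], rule exI[of _ b], intro conjI)
    show "\<exists>t\<in>T. t = trip (encode f) (pi1 (pi2 t)) v \<and> lengthc (pi1 (pi2 t)) = lengthc b \<and>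
      (\<forall>i<lengthc b. trip (nthc b i) ?l (nthc (pi1 (pi2 t)) i) \<in> T)"
      by (rule bexI[of _ "trip (encode f) (list_encode ys) v"])
        (auto simp: T_def b_def ys_def lengthc_list_encode nthc_list_encode)
  qed (simp_all add: pair_lt_code)
  moreover have "certified t" if "t \<in> T" for t
    using that Comp.IH(1)[OF f] Comp.IH(2)[OF nth_mem] def
    by (auto simp: T_def ys_def)
  moreover have "finite T" unfolding T_def by simp
  ultimately have "certified (trip (4 * pair (encode f) b + 3) ?l v)"
    by (intro certified_step[of T])
  then show ?case by (simp add: b_def pair_def)
next
  case (PrimRec f g)
  define e where "e = 4 * pair (encode f) (encode g) + 4"
  have e: "encode (PrimRec f g) = e" by (simp add: e_def pair_def)
  have just: "justified T e (consc n (list_encode ys)) u" if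
    "if n = 0 then trip (encode f) (list_encode ys) u \<in> T
     else \<exists>t\<in>T. t = trip e (consc (n - 1) (list_encode ys)) (pi2 (pi2 t)) \<and>
       trip (encode g) (consc (n - 1) (consc (pi2 (pi2 t)) (list_encode ys))) u \<in> T"
    for T n ys u
    unfolding justified_def
  proof (rule disjI2, rule disjI2, rule disjI2, rule disjI2, rule disjI1,
      rule exI[of _ "encode f"], rule conjI[rotated], rule exI[of _ "encode g"], intro conjI)
    show "consc n (list_encode ys) \<noteq> 0" by simp
  qed (use that in \<open>simp_all only: hdc_consc tlc_consc e_def pair_lt_code\<close>)
  have "eval (PrimRec f g) (n # ys) = Some u \<Longrightarrow> certified (trip e (list_encode (n # ys)) u)" for n ys u
  proof (induction n arbitrary: u)
    case 0
    then have "eval f ys = Some u" by simp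
    then have "certified (trip (encode f) (list_encode ys) u)" by (rule PrimRec.IH)
    then have "certified (trip e (consc 0 (list_encode ys)) u)"
      by (intro certified_step[of "{trip (encode f) (list_encode ys) u}"] just) auto
    then show ?case by simp
  next
    case (Suc n)
    then obtain r where r: "eval (PrimRec f g) (n # ys) = Some r" "eval g (n # r # ys) = Some u"
      by (auto split: option.splits)
    let ?s = "trip e (consc n (list_encode ys)) r"
    let ?t = "trip (encode g) (consc n (consc r (list_encode ys))) u"
    have s: "certified ?s" "certified ?t"
      using Suc.IH[OF r(1)] PrimRec.IH(2)[OF r(2)] by simp_all
    have "justified {?s, ?t} e (consc (Suc n) (list_encode ys)) u"
      by (rule just) simp
    then have "certified (trip e (consc (Suc n) (list_encode ys)) u)"
      using s by (intro certified_step[of "{?s, ?t}"]) auto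
    then show ?case by simp
  qed
  moreover obtain n ys where "xs = n # ys" using PrimRec.prems by (cases xs) auto
  ultimately show ?case using PrimRec.prems e by metis
next
  case (Mu f)
  let ?l = "list_encode xs"
  from Mu.prems have ex: "\<exists>n. eval f (n # xs) = Some 0 \<and> (\<forall>m<n. eval f (m # xs) \<noteq> None)"
    and v: "v = (LEAST n. eval f (n # xs) = Some 0)" by (auto split: if_splits)
  then obtain n where n: "eval f (n # xs) = Some 0" "\<forall>m<n. eval f (m # xs) \<noteq> None" by blast
  have v0: "eval f (v # xs) = Some 0" and "v \<le> n"
    unfolding v using n(1) by (rule LeastI, rule Least_le)
  define h where "h m = the (eval f (m # xs))" for m
  have h: "eval f (m # xs) = Some (h m)" "h m \<noteq> 0" if "m < v" for m
  proof -
    have "eval f (m # xs) \<noteq> None" using n(2) that \<open>v \<le> n\<close> by simp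
    moreover have "eval f (m # xs) \<noteq> Some 0" using that not_less_Least unfolding v by blast
    ultimately show "eval f (m # xs) = Some (h m)" "h m \<noteq> 0" unfolding h_def by auto
  qed
  define T where "T = insert (trip (encode f) (consc v ?l) 0)
    ((\<lambda>m. trip (encode f) (consc m ?l) (h m)) ` {..<v})"
  have "justified T (4 * encode f + 5) ?l v"
    unfolding justified_def
  proof (rule disjI2, rule disjI2, rule disjI2, rule disjI2, rule disjI2,
      intro exI[of _ "encode f"] conjI allI impI)
    fix m assume "m < v"
    then show "\<exists>t\<in>T. t = trip (encode f) (consc m ?l) (pi2 (pi2 t)) \<and> pi2 (pi2 t) \<noteq> 0"
      using h(2) by (intro bexI[of _ "trip (encode f) (consc m ?l) (h m)"])
        (simp_all del: consc_list_encode add: T_def)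
  qed (simp_all add: T_def)
  moreover have "certified t" if "t \<in> T" for t
    using that Mu.IH[OF v0] Mu.IH[OF h(1)] unfolding T_def consc_list_encode by blast
  moreover have "finite T" unfolding T_def by simp
  ultimately have "certified (trip (4 * encode f + 5) ?l v)"
    by (intro certified_step[of T])
  then show ?case by simp
qed

section \<open>Certificates for the unary functions \<open>phi e\<close>\<close>

definition query :: "nat \<Rightarrow> nat \<Rightarrow> nat \<Rightarrow> nat" where
  "query e x v = trip e (consc x 0) v"

lemma tc_query [tc]:
  "total_computable f \<Longrightarrow> total_computable g \<Longrightarrow> total_computable h \<Longrightarrow>
    total_computable (\<lambda>x. query (f x) (g x) (h x))"
  unfolding query_def by (intro tc)

lemma consc_0: "consc x 0 = list_encode [x]"
  using consc_list_encode[of x "[]"] by simp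

lemma query_sound: "certificate S \<Longrightarrow> query e x v \<in> S \<Longrightarrow> phi e x = Some v"
  unfolding query_def phi_def consc_0 by (rule certificate_sound)

lemma certified_query: "phi e x = Some v \<Longrightarrow> certified (query e x v)"
  unfolding query_def phi_def consc_0 using certified_eval[of "decode e" "[x]" v] by (simp only: encode_decode)

lemma set_decode_certificate_for_finite:
  assumes "finite T" "\<And>t. t \<in> T \<Longrightarrow> certified t"
  shows "\<exists>c. certificate (set_decode c) \<and> T \<subseteq> set_decode c"
  using certificate_for_finite[OF assms] by (metis set_encode_inverse)

text \<open>Kleene's normal form: the graph of \<open>phi\<close> is the projection of a decidable
  relation, with the code of a certificate as witness.\<close>

lemma phi_eq_Some_iff:
  "phi e x = Some v \<longleftrightarrow> (\<exists>c. certificate (set_decode c) \<and> query e x v \<in> set_decode c)"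
  using query_sound set_decode_certificate_for_finite[of "{query e x v}"] certified_query by auto

section \<open>Finite stages of the jump\<close>

text \<open>A stage bounds the code of a certificate rather than the length of a computation. This
  makes halting by stage \<open>s\<close> decidable and increasing in \<open>s\<close>.\<close>

definition halts_by :: "nat \<Rightarrow> nat \<Rightarrow> nat \<Rightarrow> bool" where
  "halts_by s x v \<longleftrightarrow> (\<exists>c<s. certificate (set_decode c) \<and> query x x v \<in> set_decode c)"

definition H_stage :: "nat \<Rightarrow> (nat \<times> nat) set" where
  "H_stage s = {(x, y). x = y \<or> (\<exists>v. halts_by s x v \<and> halts_by s y v)}"

abbreviation H_jump :: "nat \<Rightarrow> (nat \<times> nat) set" where
  "H_jump n \<equiv> (sat_jump ^^ n) H_rel"

abbreviation H_jump_stage :: "nat \<Rightarrow> nat \<Rightarrow> (nat \<times> nat) set" where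
  "H_jump_stage n s \<equiv> (sat_jump ^^ n) (H_stage s)"

text \<open>
  The \<open>n\<close>-fold jump relates codes of sets of rank \<open>n\<close>; \<open>atoms n x\<close> is the set of numbers at the
  bottom level of such a set, where the jump compares by \<^const>\<open>H_rel\<close>.
\<close>

primrec atoms :: "nat \<Rightarrow> nat \<Rightarrow> nat set" where
  "atoms 0 x = {x}"
| "atoms (Suc n) x = (\<Union>b\<in>set_decode x. atoms n b)"

lemma atoms_le: "a \<in> atoms n x \<Longrightarrow> a \<le> x"
  by (induction n arbitrary: x) (auto dest!: less_of_mem_set_decode, fastforce)

lemma finite_atoms: "finite (atoms n x)"
  using atoms_le by (metis finite_nat_set_iff_bounded_le)

lemma halts_by_mono: "halts_by s x v \<Longrightarrow> s \<le> s' \<Longrightarrow> halts_by s' x v"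
  unfolding halts_by_def by (meson less_le_trans)

lemma halts_by_phi: "halts_by s x v \<Longrightarrow> phi x x = Some v"
  unfolding halts_by_def phi_eq_Some_iff by blast

lemma halts_by_unique: "halts_by s x v \<Longrightarrow> halts_by s' x v' \<Longrightarrow> v = v'"
  by (auto dest!: halts_by_phi)

lemma phi_iff_halts_by: "phi x x = Some v \<longleftrightarrow> (\<exists>s. halts_by s x v)"
  unfolding halts_by_def phi_eq_Some_iff by blast

section \<open>Approximation of the jump by its stages\<close>

lemma equiv_H_stage: "equiv UNIV (H_stage s)"
proof (rule equivI)
  show "trans (H_stage s)"
    unfolding H_stage_def by (rule transI) (auto dest: halts_by_unique)
qed (auto simp: H_stage_def refl_on_def sym_def)

lemma equiv_H_rel: "equiv UNIV H_rel"
  by (rule equivI) (auto simp: H_rel_def refl_on_def sym_def trans_def)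

lemma equiv_sat_jump: "equiv UNIV (sat_jump E)"
  by (rule equivI) (auto simp: sat_jump_def refl_on_def sym_def trans_def)

lemma equiv_sat_jump_funpow: "equiv UNIV E \<Longrightarrow> equiv UNIV ((sat_jump ^^ n) E)"
  by (cases n) (auto simp: equiv_sat_jump)

text \<open>Replaces the equality of saturations, which may be infinite sets, by quantifiers over
  the coded finite sets. This form is decidable when \<open>E\<close> is, and visibly monotone in
  \<open>E\<close>.\<close>

lemma sat_jump_iff:
  assumes "equiv UNIV E"
  shows "(x, y) \<in> sat_jump E \<longleftrightarrow> (\<forall>a\<in>set_decode x. \<exists>b\<in>set_decode y. (a, b) \<in> E) \<and>
    (\<forall>b\<in>set_decode y. \<exists>a\<in>set_decode x. (a, b) \<in> E)"
proof -
  have "refl E" "sym E" "trans E" using assms by (auto elim: equivE)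
  have sub: "E `` set_decode x \<subseteq> E `` set_decode y \<longleftrightarrow>
      (\<forall>a\<in>set_decode x. \<exists>b\<in>set_decode y. (a, b) \<in> E)" for x y
  proof
    assume L: "E `` set_decode x \<subseteq> E `` set_decode y"
    show "\<forall>a\<in>set_decode x. \<exists>b\<in>set_decode y. (a, b) \<in> E"
    proof
      fix a assume "a \<in> set_decode x"
      then have "a \<in> E `` set_decode x" using \<open>refl E\<close> by (auto simp: refl_on_def)
      then show "\<exists>b\<in>set_decode y. (a, b) \<in> E" using L \<open>sym E\<close> by (blast dest: symD)
    qed
  next
    assume R: "\<forall>a\<in>set_decode x. \<exists>b\<in>set_decode y. (a, b) \<in> E"
    show "E `` set_decode x \<subseteq> E `` set_decode y"
    proof
      fix z assume "z \<in> E `` set_decode x"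
      then obtain a b where "(a, z) \<in> E" "b \<in> set_decode y" "(a, b) \<in> E" using R by blast
      then show "z \<in> E `` set_decode y" using \<open>sym E\<close> \<open>trans E\<close> by (blast dest: symD transD)
    qed
  qed
  have "(a, b) \<in> E \<longleftrightarrow> (b, a) \<in> E" for a b using \<open>sym E\<close> by (blast dest: symD)
  then show ?thesis
    unfolding sat_jump_def set_eq_subset mem_Collect_eq case_prod_conv sub by simp
qed

lemma sat_jump_cong:
  assumes "equiv UNIV E" "equiv UNIV E'"
    "\<And>a b. a \<in> set_decode x \<Longrightarrow> b \<in> set_decode y \<Longrightarrow> (a, b) \<in> E \<Longrightarrow> (a, b) \<in> E'"
    "(x, y) \<in> sat_jump E"
  shows "(x, y) \<in> sat_jump E'"
  using assms(3,4) unfolding sat_jump_iff[OF assms(1)] sat_jump_iff[OF assms(2)] by blast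

lemma sat_jump_funpow_mono:
  assumes "equiv UNIV E" "equiv UNIV E'" "E \<subseteq> E'"
  shows "(sat_jump ^^ n) E \<subseteq> (sat_jump ^^ n) E'"
proof (induction n)
  case (Suc n)
  show ?case
  proof (rule subrelI)
    fix x y assume "(x, y) \<in> (sat_jump ^^ Suc n) E"
    then have "(x, y) \<in> sat_jump ((sat_jump ^^ n) E')"
      using Suc by (intro sat_jump_cong[OF equiv_sat_jump_funpow[OF assms(1)]
        equiv_sat_jump_funpow[OF assms(2)]]) auto
    then show "(x, y) \<in> (sat_jump ^^ Suc n) E'" by simp
  qed
qed (use assms in simp)

lemma H_jump_stage_mono: "s \<le> s' \<Longrightarrow> H_jump_stage n s \<subseteq> H_jump_stage n s'"
  by (rule sat_jump_funpow_mono[OF equiv_H_stage equiv_H_stage])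
    (auto simp: H_stage_def intro: halts_by_mono)

lemma H_jump_stage_subset: "H_jump_stage n s \<subseteq> H_jump n"
  by (rule sat_jump_funpow_mono[OF equiv_H_stage equiv_H_rel])
    (auto simp: H_stage_def H_rel_def dest: halts_by_phi)

lemma eventually_ball_finite_nat:
  fixes Q :: "'a \<Rightarrow> nat \<Rightarrow> bool"
  assumes "finite A" "\<And>a. a \<in> A \<Longrightarrow> \<exists>s. Q a s" "\<And>a s s'. Q a s \<Longrightarrow> s \<le> s' \<Longrightarrow> Q a s'"
  shows "\<exists>s. \<forall>a\<in>A. Q a s"
  using assms(1,2)
proof (induction rule: finite_induct)
  case (insert a A)
  then obtain s t where "\<forall>a\<in>A. Q a s" "Q a t" by blast
  then have "\<forall>a\<in>insert a A. Q a (max s t)" using assms(3) by (metis insertE max.cobounded1 max.cobounded2)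
  then show ?case by blast
qed simp

text \<open>A pair of sets is compared through finitely many pairs of members. Each related pair of
  members appears at some stage, and monotonicity gives a stage common to all of them.\<close>

lemma H_jump_exhausted: "(x, y) \<in> H_jump n \<Longrightarrow> \<exists>s. (x, y) \<in> H_jump_stage n s"
proof (induction n arbitrary: x y)
  case 0
  then consider "x = y" | v where "phi x x = Some v" "phi y y = Some v"
    by (auto simp: H_rel_def)
  then show ?case
  proof cases
    case 2
    then obtain s t where "halts_by s x v" "halts_by t y v" unfolding phi_iff_halts_by by blast
    then have "halts_by (max s t) x v" "halts_by (max s t) y v"
      using halts_by_mono max.cobounded1 max.cobounded2 by blast+
    then show ?thesis unfolding H_stage_def by auto
  qed (simp add: H_stage_def)
next
  case (Suc n)
  have E: "equiv UNIV (H_jump n)" "\<And>s. equiv UNIV (H_jump_stage n s)"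
    by (simp_all add: equiv_sat_jump_funpow equiv_H_rel equiv_H_stage)
  let ?A = "(set_decode x \<times> set_decode y) \<inter> H_jump n"
  have "\<exists>s. \<forall>p\<in>?A. p \<in> H_jump_stage n s"
    by (rule eventually_ball_finite_nat) (use Suc.IH subsetD[OF H_jump_stage_mono] in auto)
  then obtain s where "\<forall>p\<in>?A. p \<in> H_jump_stage n s" by blast
  then have "(x, y) \<in> sat_jump (H_jump_stage n s)"
    using Suc.prems by (intro sat_jump_cong[OF E(1) E(2)]) auto
  then show ?case by auto
qed

section \<open>Decidability of the stages\<close>

lemma decidable_halts_by:
  assumes "total_computable f" "total_computable g" "total_computable h"
  shows "decidable (\<lambda>x. halts_by (f x) (g x) (h x))"
  unfolding halts_by_def
  by (intro tc assms tc_comp[OF assms(1)] tc_comp[OF assms(2)] tc_comp[OF assms(3)])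

text \<open>The output is part of the query, which is an element of the set coded by
  \<open>c\<close>. Thus the search for a common output in \<open>H_stage s\<close> is bounded by
  \<open>s\<close>.\<close>

lemma halts_by_less:
  assumes "halts_by s x v" shows "v < s"
proof -
  obtain c where c: "c < s" "query x x v \<in> set_decode c" using assms unfolding halts_by_def by blast
  have "v \<le> query x x v" unfolding query_def trip_def
    using le_pair(2)[of v "consc x 0"] le_pair(2)[of "pair (consc x 0) v" x] by linarith
  then show ?thesis using c less_of_mem_set_decode by fastforce
qed

lemma decidable_H_jump_stage:
  "decidable (\<lambda>z. (pi1 z, pi1 (pi2 z)) \<in> H_jump_stage n (pi2 (pi2 z)))"
proof (induction n)
  case 0
  have "(x, y) \<in> H_stage s \<longleftrightarrow> x = y \<or> (\<exists>v<s. halts_by s x v \<and> halts_by s y v)" for x y s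
    unfolding H_stage_def using halts_by_less by auto
  then show ?case by (simp only: funpow_0) (intro tc decidable_halts_by)
next
  case (Suc n)
  have D: "decidable (\<lambda>z. (f z, g z) \<in> H_jump_stage n (h z))"
    if "total_computable f" "total_computable g" "total_computable h" for f g h
    using decidable_comp[OF Suc, of "\<lambda>z. pair (f z) (pair (g z) (h z))"] that
    by (simp add: tc_pair)
  show ?case
    unfolding funpow.simps(2) o_apply sat_jump_iff[OF equiv_sat_jump_funpow[OF equiv_H_stage]]
    by (intro tc D)
qed

lemma decidable_H_jump_stage' [tc]:
  assumes "total_computable f" "total_computable g" "total_computable h"
  shows "decidable (\<lambda>z. (f z, g z) \<in> H_jump_stage n (h z))"
  using decidable_comp[OF decidable_H_jump_stage, of "\<lambda>z. pair (f z) (pair (g z) (h z))"] assms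
  by (simp add: tc_pair)

lemma decidable_mem_atoms [tc]:
  assumes "total_computable f" "total_computable g"
  shows "decidable (\<lambda>x. f x \<in> atoms n (g x))"
  using assms
proof (induction n arbitrary: f g)
  case (Suc n)
  show ?case
    unfolding atoms.simps UN_iff by (intro tc Suc.IH Suc.prems tc_comp[OF Suc.prems(1)])
qed (simp add: decidable_eq)

section \<open>The combinatorial core\<close>

definition determined :: "nat \<Rightarrow> nat set" where
  "determined s = {a. \<exists>v. halts_by s a v}"

text \<open>Every member has a related partner, down to the bottom level, where two related numbers
  are equal or both determined.\<close>

lemma atoms_of_related:
  "(x, y) \<in> H_jump_stage n s \<Longrightarrow> a \<in> atoms n x \<Longrightarrow> a \<in> determined s \<or> a \<in> atoms n y"
proof (induction n arbitrary: x y)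
  case 0
  then show ?case by (auto simp: H_stage_def determined_def)
next
  case (Suc n)
  then obtain b where b: "b \<in> set_decode x" "a \<in> atoms n b" by auto
  moreover obtain b' where "b' \<in> set_decode y" "(b, b') \<in> H_jump_stage n s"
    using Suc.prems b(1) sat_jump_iff[OF equiv_sat_jump_funpow[OF equiv_H_stage]] by auto
  ultimately show ?case using Suc.IH by auto
qed

text \<open>Outputs never change once they appear, so a comparison of two numbers can turn positive
  between the stages only if one of them becomes determined in between.\<close>

lemma related_earlier:
  assumes "s \<le> s'" "(x, y) \<in> H_jump_stage n s'"
    "(atoms n x \<union> atoms n y) \<inter> determined s' \<subseteq> determined s"
  shows "(x, y) \<in> H_jump_stage n s"
  using assms(2,3)
proof (induction n arbitrary: x y)
  case 0
  consider "x = y" | v where "halts_by s' x v" "halts_by s' y v"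
    using 0 by (auto simp: H_stage_def)
  then show ?case
  proof cases
    case 2
    then have "x \<in> determined s" "y \<in> determined s" using 0 by (auto simp: determined_def)
    then obtain u w where uw: "halts_by s x u" "halts_by s y w" unfolding determined_def by blast
    then have "u = v" "w = v" using 2 halts_by_unique by blast+
    then show ?thesis using uw by (auto simp: H_stage_def)
  qed (simp add: H_stage_def)
next
  case (Suc n)
  have "(x, y) \<in> sat_jump (H_jump_stage n s)"
  proof (rule sat_jump_cong[OF equiv_sat_jump_funpow[OF equiv_H_stage]
        equiv_sat_jump_funpow[OF equiv_H_stage]])
    show "(x, y) \<in> sat_jump (H_jump_stage n s')" using Suc.prems by simp
    fix a b assume "a \<in> set_decode x" "b \<in> set_decode y" "(a, b) \<in> H_jump_stage n s'"
    then show "(a, b) \<in> H_jump_stage n s" using Suc.prems(2) by (intro Suc.IH) auto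
  qed
  then show ?case by simp
qed

text \<open>Positions 2i and 2i + 1 form the i-th pair. At step \<open>t\<close> the pairs 0 to
  \<open>t\<close> make up one class, and each later pair is a class by itself.\<close>

definition merged :: "nat \<Rightarrow> nat \<Rightarrow> nat \<Rightarrow> bool" where
  "merged t p q \<longleftrightarrow> p div 2 = q div 2 \<or> (p div 2 \<le> t \<and> q div 2 \<le> t)"

text \<open>Position 1 plays the role of m in the idea of the proof. Each of the
  \<open>k - 1\<close> steps after step 0 enlarges the set \<open>D t\<close> of determined numbers
  up to \<open>F 0\<close>, which has at most \<open>F 0 + 1\<close> elements.\<close>

lemma no_merging_sequence:
  fixes F :: "nat \<Rightarrow> nat" and \<sigma> :: "nat \<Rightarrow> nat"
  assumes k: "F 0 + 3 \<le> k"
    and meet: "\<And>p q. 2 \<le> p \<Longrightarrow> p < q \<Longrightarrow> q < 2 * k \<Longrightarrow> atoms n (F p) \<inter> atoms n (F q) \<subseteq> atoms n (F 1)"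
    and stages: "\<And>t p q. t < k \<Longrightarrow> p < 2 * k \<Longrightarrow> q < 2 * k \<Longrightarrow>
      (F p, F q) \<in> H_jump_stage n (\<sigma> t) \<longleftrightarrow> merged t p q"
  shows False
proof -
  have less: "\<sigma> t < \<sigma> (Suc t)" if "Suc t < k" for t
  proof (rule ccontr)
    assume "\<not> \<sigma> t < \<sigma> (Suc t)"
    then have "H_jump_stage n (\<sigma> (Suc t)) \<subseteq> H_jump_stage n (\<sigma> t)"
      by (intro H_jump_stage_mono) simp
    moreover have "(F 0, F (2 * Suc t)) \<in> H_jump_stage n (\<sigma> (Suc t))"
      "(F 0, F (2 * Suc t)) \<notin> H_jump_stage n (\<sigma> t)"
      using that by (subst stages; simp add: merged_def)+
    ultimately show False by blast
  qed
  have pairs: "(F p, F q) \<in> H_jump_stage n (\<sigma> 0)" if "p div 2 = q div 2" "p < 2 * k" "q < 2 * k" for p q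
    using that k by (subst stages) (auto simp: merged_def)
  have F1: "a \<in> determined (\<sigma> 0) \<or> a \<le> F 0" if "a \<in> atoms n (F 1)" for a
    using atoms_of_related[OF pairs[of 1 0] that] k atoms_le by auto
  \<comment> \<open>From position 2 on, an undetermined atom also lies in the partner of
    \<open>p\<close>, hence by \<open>meet\<close> in \<open>F 1\<close>, where \<open>F1\<close>
    bounds it.\<close>
  have small: "a \<in> determined (\<sigma> 0) \<or> a \<le> F 0" if "p < 2 * k" "a \<in> atoms n (F p)" for a p
  proof -
    consider "p = 0" | "p = 1" | "p \<ge> 2" "even p" | "p \<ge> 2" "odd p" by linarith
    then show ?thesis
    proof cases
      case 1
      then show ?thesis using that atoms_le by blast
    next
      case 2
      then show ?thesis using that F1 by blast
    next
      case 3
      then have *: "Suc p < 2 * k" "p div 2 = Suc p div 2" using that by (auto elim!: evenE)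
      show ?thesis
        using atoms_of_related[OF pairs[OF *(2) that(1) *(1)] that(2)]
          meet[of p "Suc p"] 3 * F1 that(2) by blast
    next
      case 4
      then obtain r where r: "p = Suc r" "even r" "2 \<le> r" by (cases p) (auto elim!: evenE)
      then have *: "r < 2 * k" "p div 2 = r div 2" using that by auto
      show ?thesis
        using atoms_of_related[OF pairs[OF *(2) that(1) *(1)] that(2)]
          meet[of r p] r that F1 by blast
    qed
  qed
  define D where "D t = determined (\<sigma> t) \<inter> {..F 0}" for t
  have le: "\<sigma> 0 \<le> \<sigma> t" if "t < k" for t
    using that by (induction t) (auto dest: less)
  have mono: "determined s \<subseteq> determined s'" if "s \<le> s'" for s s'
    using that halts_by_mono unfolding determined_def by blast
  \<comment> \<open>Were no new number up to \<open>F 0\<close> determined, then by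
    \<open>small\<close> no relevant atom would be new, and \<open>related_earlier\<close> would
    move the merge of pair \<open>Suc t\<close> with pair 0 back to stage
    \<open>\<sigma> t\<close>.\<close>
  have grow: "card (D t) < card (D (Suc t))" if "Suc t < k" for t
  proof (rule psubset_card_mono)
    show "D t \<subset> D (Suc t)"
    proof (rule ccontr)
      assume no: "\<not> D t \<subset> D (Suc t)"
      have "D t \<subseteq> D (Suc t)" using mono[of "\<sigma> t" "\<sigma> (Suc t)"] less[OF that] unfolding D_def by auto
      with no have eq: "D (Suc t) \<subseteq> D t" by blast
      let ?x = "F 0" and ?y = "F (2 * Suc t)"
      have "(atoms n ?x \<union> atoms n ?y) \<inter> determined (\<sigma> (Suc t)) \<subseteq> determined (\<sigma> t)"
        using small[of 0] small[of "2 * Suc t"] mono[OF le[of t]] eq that unfolding D_def by auto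
      moreover have "(?x, ?y) \<in> H_jump_stage n (\<sigma> (Suc t))" "(?x, ?y) \<notin> H_jump_stage n (\<sigma> t)"
        using that by (subst stages; simp add: merged_def)+
      ultimately show False using related_earlier less[OF that] by (meson less_imp_le)
    qed
  qed (simp add: D_def)
  have "t \<le> card (D t)" if "t < k" for t
    using that by (induction t) (use grow in \<open>fastforce+\<close>)
  moreover have "card (D t) \<le> card {..F 0}" for t
    unfolding D_def by (rule card_mono) auto
  \<comment> \<open>Both bounds are taken at the last step \<open>t = k - 1\<close>.\<close>
  ultimately have "k - 1 \<le> Suc (F 0)"
    using k by (metis card_atMost diff_less le_trans less_le_trans zero_less_numeral zero_less_one add_gr_0)
  then show False using k by simp
qed

section \<open>Selection of sets by the infinite pigeonhole principle\<close>

lemma infinite_trace_constant: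
  fixes A :: "nat \<Rightarrow> nat set"
  assumes "infinite J" "finite B"
  shows "\<exists>J'\<subseteq>J. infinite J' \<and> (\<forall>i\<in>J'. \<forall>j\<in>J'. A i \<inter> B = A j \<inter> B)"
proof -
  have "finite ((\<lambda>i. A i \<inter> B) ` J)"
    using assms(2) by (rule finite_subset[rotated, OF finite_Pow_iff[THEN iffD2]]) blast
  then obtain i where i: "i \<in> J" "infinite {j \<in> J. A j \<inter> B = A i \<inter> B}"
    using pigeonhole_infinite[OF assms(1)] by blast
  then show ?thesis by (intro exI[of _ "{j \<in> J. A j \<inter> B = A i \<inter> B}"]) auto
qed

text \<open>After choosing \<open>i\<close>, the remaining indices are thinned out until all their
  sets have the same trace on \<open>A i\<close>. Then
  \<open>A i \<inter> A j = A i \<inter> A l\<close> for all later \<open>j\<close> and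
  \<open>l\<close>, so the meet lies in \<open>A l\<close>. Repeating this \<open>m\<close> times
  keeps an infinite reservoir \<open>J'\<close> for \<open>l\<close>.\<close>

lemma meets_in_late_sets:
  fixes A :: "nat \<Rightarrow> nat set"
  assumes "\<And>i. finite (A i)" "infinite J"
  shows "\<exists>I J'. finite I \<and> card I = m \<and> I \<subseteq> J \<and> J' \<subseteq> J \<and> infinite J' \<and> I \<inter> J' = {} \<and>
    (\<forall>i\<in>I. \<forall>j\<in>I. \<forall>l\<in>J'. i \<noteq> j \<longrightarrow> A i \<inter> A j \<subseteq> A l)"
  using assms(2)
proof (induction m arbitrary: J)
  case 0
  then show ?case by (intro exI[of _ "{}"] exI[of _ J]) auto
next
  case (Suc m)
  obtain i where i: "i \<in> J" using Suc.prems infinite_imp_nonempty by blast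
  obtain J1 where J1: "J1 \<subseteq> J - {i}" "infinite J1" "\<forall>p\<in>J1. \<forall>q\<in>J1. A p \<inter> A i = A q \<inter> A i"
    using infinite_trace_constant[of "J - {i}" "A i" A] Suc.prems assms(1) by auto
  obtain I J' where IJ: "finite I" "card I = m" "I \<subseteq> J1" "J' \<subseteq> J1" "infinite J'" "I \<inter> J' = {}"
    "\<forall>i\<in>I. \<forall>j\<in>I. \<forall>l\<in>J'. i \<noteq> j \<longrightarrow> A i \<inter> A j \<subseteq> A l"
    using Suc.IH[OF J1(2)] by blast
  have new: "A i \<inter> A j \<subseteq> A l" if "j \<in> I" "l \<in> J'" for j l
    using J1(3) IJ(3,4) that by blast
  have "\<forall>p\<in>insert i I. \<forall>q\<in>insert i I. \<forall>l\<in>J'. p \<noteq> q \<longrightarrow> A p \<inter> A q \<subseteq> A l"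
    using new IJ(7) by blast
  moreover have "card (insert i I) = Suc m" using IJ J1 by (subst card_insert_disjoint) auto
  moreover have "insert i I \<subseteq> J" "J' \<subseteq> J" "insert i I \<inter> J' = {}" using IJ J1 i by blast+
  ultimately show ?case using IJ(1,5)
    by (intro exI[of _ "insert i I"] exI[of _ J']) simp
qed

section \<open>The diagonal relation\<close>

text \<open>The entries of \<open>L\<close> are the indices 0, m, p1, q1, and so on, in the order of
  the positions in \<open>merged\<close>. Entry 0 is fixed as 0 because \<open>F 0\<close>
  determines the number \<open>F 0 + 3\<close> of pairs. The bound on \<open>a\<close> is that of
  \<open>atoms_le\<close> and makes the inclusion of atoms decidable.\<close>

definition valid_config :: "nat \<Rightarrow> (nat \<Rightarrow> nat) \<Rightarrow> nat \<Rightarrow> bool" where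
  "valid_config n F L \<longleftrightarrow> nthc L 0 = 0 \<and>
     (\<forall>q<2 * F 0 + 6. \<forall>p<q. nthc L p \<noteq> nthc L q \<and>
       (2 \<le> p \<longrightarrow> (\<forall>a<Suc (F (nthc L p)). a \<in> atoms n (F (nthc L p)) \<and> a \<in> atoms n (F (nthc L q))
          \<longrightarrow> a \<in> atoms n (F (nthc L 1)))))"

definition realised :: "nat \<Rightarrow> (nat \<Rightarrow> nat) \<Rightarrow> nat \<Rightarrow> nat \<Rightarrow> nat \<Rightarrow> bool" where
  "realised n F L t s \<longleftrightarrow> (\<forall>p<2 * F 0 + 6. \<forall>q<2 * F 0 + 6.
     (F (nthc L p), F (nthc L q)) \<in> H_jump_stage n s \<longleftrightarrow> merged t p q)"

definition glued :: "(nat \<Rightarrow> nat) \<Rightarrow> nat \<Rightarrow> nat \<Rightarrow> nat \<Rightarrow> nat \<Rightarrow> bool" where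
  "glued F L t i j \<longleftrightarrow>
     (\<exists>p<2 * F 0 + 6. \<exists>q<2 * F 0 + 6. i = nthc L p \<and> j = nthc L q \<and> merged t p q)"

text \<open>A junk value where \<^term>\<open>phi e (pair e i)\<close> is undefined; \<open>active\<close> excludes these.\<close>

definition column :: "nat \<Rightarrow> nat \<Rightarrow> nat" where
  "column e i = the (phi e (pair e i))"

text \<open>Step \<open>t\<close> is performed once all earlier steps have been matched by a stage
  of the jump. Taking the least valid \<open>L\<close> makes the configuration unique, and the
  column values up to \<open>L\<close> suffice to recognise it.\<close>

definition active :: "nat \<Rightarrow> nat \<Rightarrow> nat \<Rightarrow> nat \<Rightarrow> bool" where
  "active n e L t \<longleftrightarrow> (\<forall>m<Suc L. phi e (pair e m) \<noteq> None) \<and>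
     valid_config n (column e) L \<and> (\<forall>L'<L. \<not> valid_config n (column e) L') \<and>
     (\<forall>t'<t. \<exists>s. realised n (column e) L t' s)"

text \<open>Column \<open>e\<close> consists of the numbers \<open>pair e i\<close> and treats
  \<open>phi e\<close> as the candidate reduction. Columns never meet, so the candidates are handled
  independently.\<close>

definition diag_rel :: "nat \<Rightarrow> (nat \<times> nat) set" where
  "diag_rel n = {(x, y). x = y \<or> pi1 x = pi1 y \<and>
     (\<exists>L t. active n (pi1 x) L t \<and> glued (column (pi1 x)) L t (pi2 x) (pi2 y))}"

lemma diag_relE:
  assumes "(x, y) \<in> diag_rel n" "x \<noteq> y"
  obtains L t where "pi1 x = pi1 y" "active n (pi1 y) L t" "glued (column (pi1 y)) L t (pi2 x) (pi2 y)"
proof -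
  have "pi1 x = pi1 y \<and> (\<exists>L t. active n (pi1 x) L t \<and> glued (column (pi1 x)) L t (pi2 x) (pi2 y))"
    using assms unfolding diag_rel_def mem_Collect_eq case_prod_conv
    by (elim disjE) (erule notE, assumption, assumption)
  then show ?thesis by (elim exE conjE) (rule that, simp_all)
qed

lemma diag_relI:
  assumes "pi1 x = pi1 y" "active n (pi1 y) L t" "glued (column (pi1 y)) L t (pi2 x) (pi2 y)"
  shows "(x, y) \<in> diag_rel n"
  unfolding diag_rel_def mem_Collect_eq case_prod_conv assms(1)
  by (intro disjI2 conjI refl exI) (rule assms(2), rule assms(3))

lemma active_valid: "active n e L t \<Longrightarrow> valid_config n (column e) L"
  by (simp add: active_def)

lemma active_unique: "active n e L t \<Longrightarrow> active n e L' t' \<Longrightarrow> L = L'"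
  unfolding active_def by (meson linorder_neqE_nat)

lemma active_max: "active n e L t \<Longrightarrow> active n e L t' \<Longrightarrow> active n e L (max t t')"
  by (simp add: max_def)

lemma valid_config_inj:
  assumes "valid_config n F L" "p < 2 * F 0 + 6" "q < 2 * F 0 + 6" "nthc L p = nthc L q"
  shows "p = q"
  using assms unfolding valid_config_def by (metis linorder_neqE_nat)

lemma merged_sym: "merged t p q \<Longrightarrow> merged t q p"
  by (auto simp: merged_def)

lemma merged_trans: "merged t p q \<Longrightarrow> merged t' q r \<Longrightarrow> merged (max t t') p r"
  by (auto simp: merged_def)

text \<open>The entries of a valid configuration are distinct, so the middle index \<open>j\<close>
  has one position and the two merges can be composed there.\<close>

lemma glued_trans:
  assumes "valid_config n F L" "glued F L t i j" "glued F L t' j l"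
  shows "glued F L (max t t') i l"
proof -
  let ?K = "2 * F 0 + 6"
  obtain p q where pq: "p < ?K" "q < ?K" "i = nthc L p" "j = nthc L q" "merged t p q"
    using assms(2) unfolding glued_def by blast
  obtain q' r where qr: "q' < ?K" "r < ?K" "j = nthc L q'" "l = nthc L r" "merged t' q' r"
    using assms(3) unfolding glued_def by blast
  have "q' = q" using valid_config_inj[OF assms(1) qr(1) pq(2)] pq qr by simp
  then have "merged (max t t') p r" using merged_trans pq qr by blast
  then show ?thesis unfolding glued_def using pq qr by blast
qed

lemma equiv_diag_rel: "equiv UNIV (diag_rel n)"
proof (rule equivI)
  show "refl (diag_rel n)" unfolding diag_rel_def by (auto simp: refl_on_def)
  show "sym (diag_rel n)"
  proof (rule symI)
    have glued: "glued F L t j i" if ij: "glued F L t i j" for F L t i j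
    proof -
      obtain p q where "p < 2 * F 0 + 6" "q < 2 * F 0 + 6" "i = nthc L p" "j = nthc L q" "merged t p q"
        using ij unfolding glued_def by (elim exE conjE)
      then show ?thesis
        unfolding glued_def by (intro exI[of _ q] exI[of _ p] conjI) (simp_all add: merged_sym)
    qed
    fix x y assume xy: "(x, y) \<in> diag_rel n"
    show "(y, x) \<in> diag_rel n"
    proof (cases "x = y")
      case False
      show ?thesis using diag_relE[OF xy False] glued diag_relI by metis
    qed (use xy in simp)
  qed
  show "trans (diag_rel n)"
  proof (rule transI)
    fix x y z assume xy: "(x, y) \<in> diag_rel n" and yz: "(y, z) \<in> diag_rel n"
    show "(x, z) \<in> diag_rel n"
    proof (cases "x = y \<or> y = z")
      case False
      obtain L t where 1: "pi1 x = pi1 y" "active n (pi1 y) L t"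
        "glued (column (pi1 y)) L t (pi2 x) (pi2 y)"
        using diag_relE[OF xy] False by metis
      obtain L' t' where 2: "pi1 y = pi1 z" "active n (pi1 z) L' t'"
        "glued (column (pi1 z)) L' t' (pi2 y) (pi2 z)"
        using diag_relE[OF yz] False by metis
      have L: "L' = L" by (rule active_unique[OF 2(2) 1(2)[unfolded 2(1)]])
      show ?thesis
      proof (rule diag_relI)
        show "pi1 x = pi1 z" using 1(1) 2(1) by simp
        show "active n (pi1 z) L (max t t')"
          by (rule active_max[OF 1(2)[unfolded 2(1)] 2(2)[unfolded L]])
        show "glued (column (pi1 z)) L (max t t') (pi2 x) (pi2 z)"
          by (rule glued_trans[OF active_valid 1(3)[unfolded 2(1)] 2(3)[unfolded L]])
            (rule 1(2)[unfolded 2(1)])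
      qed
    qed (use xy yz in auto)
  qed
qed simp

section \<open>Computable enumerability of the diagonal relation\<close>

definition table :: "nat \<Rightarrow> nat \<Rightarrow> nat \<Rightarrow> nat \<Rightarrow> bool" where
  "table c g e L \<longleftrightarrow> certificate (set_decode c) \<and>
     (\<forall>m<Suc L. query e (pair e m) (nthc g m) \<in> set_decode c)"

lemma table_column: "table c g e L \<Longrightarrow> m \<le> L \<Longrightarrow> phi e (pair e m) = Some (nthc g m)"
  unfolding table_def using query_sound by fastforce

lemma ex_table_iff: "(\<exists>c g. table c g e L) \<longleftrightarrow> (\<forall>m<Suc L. phi e (pair e m) \<noteq> None)"
proof
  assume "\<forall>m<Suc L. phi e (pair e m) \<noteq> None"
  moreover obtain g where "\<forall>m<Suc L. nthc g m = column e m" using ex_nthc by blast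
  ultimately have g: "\<forall>m<Suc L. phi e (pair e m) = Some (nthc g m)"
    by (simp add: column_def)
  let ?T = "(\<lambda>m. query e (pair e m) (nthc g m)) ` {..<Suc L}"
  have "certified t" if "t \<in> ?T" for t using that g certified_query by auto
  then obtain c where "certificate (set_decode c)" "?T \<subseteq> set_decode c"
    using set_decode_certificate_for_finite[of ?T] by auto
  then have "table c g e L" unfolding table_def by auto
  then show "\<exists>c g. table c g e L" by blast
qed (use table_column in fastforce)

lemma valid_config_cong:
  assumes "\<And>m. m \<le> L \<Longrightarrow> F m = F' m"
  shows "valid_config n F L = valid_config n F' L"
proof -
  have "F 0 = F' 0" "F (nthc L p) = F' (nthc L p)" for p using assms nthc_le by simp_all
  then show ?thesis unfolding valid_config_def by (simp only:)
qed

lemma realised_cong: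
  assumes "\<And>m. m \<le> L \<Longrightarrow> F m = F' m"
  shows "realised n F L t s = realised n F' L t s"
proof -
  have "F 0 = F' 0" "F (nthc L p) = F' (nthc L p)" for p using assms nthc_le by simp_all
  then show ?thesis unfolding realised_def by (simp only:)
qed

text \<open>Collection: finitely many stages have a common bound, so the unbounded search can be
  moved in front of the bounded quantifier.\<close>

lemma ex_bound_iff:
  fixes P :: "nat \<Rightarrow> nat \<Rightarrow> bool"
  shows "(\<exists>b. \<forall>t'<t. \<exists>s<b. P t' s) \<longleftrightarrow> (\<forall>t'<t. \<exists>s. P t' s)"
proof
  assume *: "\<forall>t'<t. \<exists>s. P t' s"
  have "\<exists>b. \<forall>t'\<in>{..<t}. \<exists>s<b. P t' s"
  proof (rule eventually_ball_finite_nat)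
    show "\<exists>b. \<exists>s<b. P t' s" if "t' \<in> {..<t}" for t'
      using * that by (metis lessI lessThan_iff)
  qed (auto intro: less_le_trans)
  then show "\<exists>b. \<forall>t'<t. \<exists>s<b. P t' s" by auto
qed blast

text \<open>Brings the condition into the form of unbounded existential quantifiers before a
  decidable matrix: \<open>g\<close> lists the column values up to \<open>L\<close>,
  \<open>c\<close> certifies them, and \<open>b\<close> bounds the stages. The minimality of
  \<open>L\<close> is then checked on the list alone.\<close>

lemma active_glued_iff:
  "active n e L t \<and> glued (column e) L t i j \<longleftrightarrow>
    (\<exists>c g b. table c g e L \<and> valid_config n (nthc g) L \<and> (\<forall>L'<L. \<not> valid_config n (nthc g) L') \<and>
       (\<forall>t'<t. \<exists>s<b. realised n (nthc g) L t' s) \<and> glued (nthc g) L t i j)"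
proof -
  let ?C = "valid_config n (column e) L \<and> (\<forall>L'<L. \<not> valid_config n (column e) L') \<and>
    (\<forall>t'<t. \<exists>s. realised n (column e) L t' s) \<and> glued (column e) L t i j"
  have "(\<exists>b. table c g e L \<and> valid_config n (nthc g) L \<and> (\<forall>L'<L. \<not> valid_config n (nthc g) L') \<and>
       (\<forall>t'<t. \<exists>s<b. realised n (nthc g) L t' s) \<and> glued (nthc g) L t i j) \<longleftrightarrow>
     table c g e L \<and> ?C" for c g
  proof (cases "table c g e L")
    case True
    have eq: "nthc g m = column e m" if "m \<le> L" for m
      using table_column[OF True that] by (simp add: column_def)
    have valid: "valid_config n (nthc g) L' = valid_config n (column e) L'" if "L' \<le> L" for L'
      using eq that by (intro valid_config_cong) simp
    have less: "(\<forall>L'<L. \<not> valid_config n (nthc g) L') = (\<forall>L'<L. \<not> valid_config n (column e) L')"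
      using valid by auto
    have real: "realised n (nthc g) L = realised n (column e) L"
      using eq by (intro ext realised_cong)
    have "nthc g 0 = column e 0" using eq by simp
    then have gl: "glued (nthc g) L t i j = glued (column e) L t i j"
      unfolding glued_def by (simp only:)
    show ?thesis
      unfolding gl real less valid[OF order_refl] ex_bound_iff[of t "realised n (column e) L", symmetric]
      using True by blast
  qed simp
  then have "(\<exists>c g b. table c g e L \<and> valid_config n (nthc g) L \<and>
      (\<forall>L'<L. \<not> valid_config n (nthc g) L') \<and>
      (\<forall>t'<t. \<exists>s<b. realised n (nthc g) L t' s) \<and> glued (nthc g) L t i j) \<longleftrightarrow>
    (\<exists>c g. table c g e L) \<and> ?C" by (simp only: ex_simps)
  then show ?thesis
    unfolding active_def ex_table_iff[symmetric] by (simp only: conj_assoc)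
qed

lemma decidable_valid_config [tc]:
  assumes "total_computable g" "total_computable l"
  shows "decidable (\<lambda>x. valid_config n (nthc (g x)) (l x))"
  unfolding valid_config_def by (intro tc assms tc_comp[OF assms(1)] tc_comp[OF assms(2)])

lemma decidable_merged [tc]:
  assumes "total_computable f" "total_computable g" "total_computable h"
  shows "decidable (\<lambda>x. merged (f x) (g x) (h x))"
  unfolding merged_def by (intro tc assms)

lemma decidable_realised [tc]:
  assumes "total_computable g" "total_computable l" "total_computable t" "total_computable s"
  shows "decidable (\<lambda>x. realised n (nthc (g x)) (l x) (t x) (s x))"
  unfolding realised_def
  by (intro tc assms tc_comp[OF assms(1)] tc_comp[OF assms(2)] tc_comp[OF assms(3)]
      tc_comp[OF assms(4)])

lemma decidable_glued [tc]:
  assumes "total_computable g" "total_computable l" "total_computable t"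
    "total_computable i" "total_computable j"
  shows "decidable (\<lambda>x. glued (nthc (g x)) (l x) (t x) (i x) (j x))"
  unfolding glued_def
  by (intro tc assms tc_comp[OF assms(1)] tc_comp[OF assms(2)] tc_comp[OF assms(3)]
      tc_comp[OF assms(4)] tc_comp[OF assms(5)])

lemma decidable_table [tc]:
  assumes "total_computable c" "total_computable g" "total_computable e" "total_computable l"
  shows "decidable (\<lambda>x. table (c x) (g x) (e x) (l x))"
  unfolding table_def
  by (intro tc assms tc_comp[OF assms(1)] tc_comp[OF assms(2)] tc_comp[OF assms(3)])

lemma ce2_diag_rel: "ce2 (diag_rel n)"
proof -
  define P where "P L t c g b x y \<longleftrightarrow> x = y \<or> pi1 x = pi1 y \<and> table c g (pi1 x) L \<and>
    valid_config n (nthc g) L \<and> (\<forall>L'<L. \<not> valid_config n (nthc g) L') \<and>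
    (\<forall>t'<t. \<exists>s<b. realised n (nthc g) L t' s) \<and> glued (nthc g) L t (pi2 x) (pi2 y)"
    for L t c g b x y
  \<comment> \<open>Packs the five witnesses into one number, as \<open>ce2_projection\<close>
    expects.\<close>
  define Q where "Q w = P (pi1 w) (pi1 (pi2 w)) (pi1 (pi2 (pi2 w))) (pi1 (pi2 (pi2 (pi2 w))))
    (pi2 (pi2 (pi2 (pi2 w))))" for w
  have "decidable (\<lambda>z. Q (pi1 z) (pi1 (pi2 z)) (pi2 (pi2 z)))"
    unfolding Q_def P_def by (intro tc)
  then have "ce2 {(x, y). \<exists>w. Q w x y}" by (rule ce2_projection)
  moreover have "(\<exists>w. Q w x y) \<longleftrightarrow> (\<exists>L t c g b. P L t c g b x y)" for x y
  proof
    assume "\<exists>L t c g b. P L t c g b x y"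
    then obtain L t c g b where "P L t c g b x y" by blast
    then have "Q (pair L (pair t (pair c (pair g b)))) x y" unfolding Q_def by simp
    then show "\<exists>w. Q w x y" by blast
  qed (unfold Q_def, blast)
  moreover have "(x, y) \<in> diag_rel n \<longleftrightarrow> (\<exists>L t c g b. P L t c g b x y)" for x y
    unfolding diag_rel_def P_def mem_Collect_eq case_prod_conv active_glued_iff by auto
  then have "diag_rel n = {(x, y). \<exists>L t c g b. P L t c g b x y}"
    by (simp add: set_eq_iff)
  ultimately show ?thesis by simp
qed

section \<open>Existence of configurations and defeat of a reduction\<close>

lemma ex_valid_config: "\<exists>L. valid_config n F L"
proof -
  define K where "K = 2 * F 0 + 6"
  define A where "A i = atoms n (F i)" for i
  \<comment> \<open>Index 0 is kept out of the selection, being reserved for position 0. The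
    \<open>K - 2\<close> indices in \<open>I\<close> fill the positions from 2 on, and
    \<open>J'\<close> supplies position 1.\<close>
  obtain I J' where IJ: "finite I" "card I = K - 2" "I \<subseteq> {1..}" "J' \<subseteq> {1..}" "infinite J'"
    "I \<inter> J' = {}" "\<forall>i\<in>I. \<forall>j\<in>I. \<forall>l\<in>J'. i \<noteq> j \<longrightarrow> A i \<inter> A j \<subseteq> A l"
    using meets_in_late_sets[of A "{1..}" "K - 2"] unfolding A_def
    by (auto simp: finite_atoms infinite_Ici)
  obtain m where m: "m \<in> J'" using IJ(5) infinite_imp_nonempty by blast
  obtain h where h: "bij_betw h {0..<K - 2} I" using ex_bij_betw_nat_finite[OF IJ(1)] IJ(2) by auto
  define u where "u p = (if p = 0 then 0 else if p = 1 then m else h (p - 2))" for p :: nat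
  obtain L where L: "\<forall>p<K. nthc L p = u p" using ex_nthc by blast
  have hI: "h (p - 2) \<in> I" if "2 \<le> p" "p < K" for p
    using bij_betw_apply[OF h] that by auto
  have inj: "u p \<noteq> u q" if "p < q" "q < K" for p q
  proof -
    have "h (p - 2) \<noteq> h (q - 2)" if "2 \<le> p"
    proof -
      have "p - 2 \<noteq> q - 2" "p - 2 \<in> {0..<K - 2}" "q - 2 \<in> {0..<K - 2}"
        using that \<open>p < q\<close> \<open>q < K\<close> by auto
      then show ?thesis using inj_on_contraD[OF bij_betw_imp_inj_on[OF h]] by blast
    qed
    moreover have "m \<noteq> 0" "m \<notin> I" "\<And>i. i \<in> I \<Longrightarrow> i \<noteq> 0" using m IJ by auto
    moreover have "p = 0 \<and> q = 1 \<or> p = 0 \<and> 2 \<le> q \<or> p = 1 \<and> 2 \<le> q \<or> 2 \<le> p \<and> 2 \<le> q"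
      using \<open>p < q\<close> by presburger
    ultimately show ?thesis
      unfolding u_def using hI[of p] hI[of q] that by (elim disjE conjE) auto
  qed
  have meet: "a \<in> A (u p) \<Longrightarrow> a \<in> A (u q) \<Longrightarrow> a \<in> A (u 1)" if "2 \<le> p" "p < q" "q < K" for a p q
    using IJ(7) hI[of p] hI[of q] m inj[of p q] that unfolding u_def by auto
  have K: "2 \<le> K" by (simp add: K_def)
  have "valid_config n F L"
    unfolding valid_config_def K_def[symmetric]
    using L inj meet K unfolding A_def by (auto simp: u_def)
  then show ?thesis by blast
qed

text \<open>A reduction has an index \<open>e\<close>, and column \<open>e\<close> was built against
  \<open>phi e\<close>. All steps turn out to be realised, which \<open>no_merging_sequence\<close>
  forbids.\<close>

lemma diag_rel_not_reducible: "\<not> diag_rel n \<le>\<^sub>c H_jump n"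
proof
  assume "diag_rel n \<le>\<^sub>c H_jump n"
  then obtain f e where e: "\<And>x. phi e x = Some (f x)"
    and red: "\<And>x y. (x, y) \<in> diag_rel n \<longleftrightarrow> (f x, f y) \<in> H_jump n"
    unfolding reducible_def total_computable_def by blast
  define F where "F = column e"
  define K where "K = 2 * F 0 + 6"
  have F: "F i = f (pair e i)" for i by (simp add: F_def column_def e)
  define L where "L = (LEAST L. valid_config n F L)"
  have L: "valid_config n F L" "\<forall>L'<L. \<not> valid_config n F L'"
    unfolding L_def using LeastI_ex[OF ex_valid_config] not_less_Least by blast+
  have active: "active n e L t \<longleftrightarrow> (\<forall>t'<t. \<exists>s. realised n F L t' s)" for t
    using L unfolding active_def F_def by (simp add: e)
  have inj: "nthc L p = nthc L q \<longleftrightarrow> p = q" if "p < K" "q < K" for p q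
    using that valid_config_inj[OF L(1)] unfolding K_def by blast
  have glued: "glued F L t (nthc L p) (nthc L q) \<longleftrightarrow> merged t p q" if "p < K" "q < K" for t p q
  proof
    assume "glued F L t (nthc L p) (nthc L q)"
    then obtain p' q' where "p' < K" "q' < K" "nthc L p = nthc L p'" "nthc L q = nthc L q'"
      "merged t p' q'"
      unfolding glued_def K_def by blast
    then show "merged t p q" using that inj by simp
  qed (use that in \<open>unfold glued_def K_def, blast\<close>)
  have col: "(F (nthc L p), F (nthc L q)) \<in> H_jump n \<longleftrightarrow> p = q \<or> (\<exists>t. active n e L t \<and> merged t p q)"
    if "p < K" "q < K" for p q
  proof -
    \<comment> \<open>Step 0 waits for nothing, so it is active; by uniqueness \<open>L\<close> is
      the only configuration used in this column.\<close>
    have "active n e L 0" using active[of 0] by simp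
    then have "L' = L" if "active n e L' t" for L' t using active_unique that by blast
    then have "(\<exists>L' t. active n e L' t \<and> glued F L' t (nthc L p) (nthc L q)) \<longleftrightarrow>
      (\<exists>t. active n e L t \<and> glued F L t (nthc L p) (nthc L q))" by metis
    then show ?thesis
      unfolding F red[symmetric] diag_rel_def mem_Collect_eq case_prod_conv pi1_pair pi2_pair
        pair_eq_iff F_def[symmetric] glued[OF that] inj[OF that] by simp
  qed
  have realised: "\<exists>s. realised n F L t s" for t
  proof (induction t rule: less_induct)
    case (less t)
    show ?case
    proof (rule ccontr)
      assume no: "\<nexists>s. realised n F L t s"
      \<comment> \<open>If step \<open>t\<close> were never realised, no later step would become
        active and the partition would remain that of step \<open>t\<close> forever. The reduction
        then transfers exactly this partition to \<open>H_jump n\<close>.\<close>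
      have "active n e L t" using active less by blast
      moreover have "t' \<le> t" if "active n e L t'" for t'
        using that no active by (meson not_le)
      moreover have "merged t' p q \<Longrightarrow> t' \<le> t \<Longrightarrow> merged t p q" for t' p q
        by (auto simp: merged_def)
      moreover have "merged t p p" for p by (simp add: merged_def)
      ultimately have "p = q \<or> (\<exists>t. active n e L t \<and> merged t p q) \<longleftrightarrow> merged t p q" for p q
        by metis
      then have E: "(F (nthc L p), F (nthc L q)) \<in> H_jump n \<longleftrightarrow> merged t p q"
        if "p < K" "q < K" for p q
        unfolding col[OF that] .
      let ?A = "{(p, q). p < K \<and> q < K \<and> merged t p q}"
      have fin: "finite ?A"
        by (rule finite_subset[of _ "{..<K} \<times> {..<K}"]) auto
      \<comment> \<open>The finitely many required relations hold together at one stage.\<close>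
      have "\<exists>s. \<forall>r\<in>?A. (F (nthc L (fst r)), F (nthc L (snd r))) \<in> H_jump_stage n s"
        by (rule eventually_ball_finite_nat[OF fin])
          (use E H_jump_exhausted subsetD[OF H_jump_stage_mono] in auto)
      then obtain s where "\<forall>r\<in>?A. (F (nthc L (fst r)), F (nthc L (snd r))) \<in> H_jump_stage n s"
        by blast
      then have "realised n F L t s"
        unfolding realised_def K_def[symmetric]
      proof (intro allI impI iffI)
        fix p q assume pq: "p < K" "q < K"
        \<comment> \<open>No stage relates too much, because each is contained in the limit
          \<open>H_jump n\<close>, which already has the right partition.\<close>
        show "merged t p q" if "(F (nthc L p), F (nthc L q)) \<in> H_jump_stage n s"
          using E[OF pq] subsetD[OF H_jump_stage_subset that] by simp
      qed auto
      then show False using no by blast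
    qed
  qed
  then obtain \<sigma> where \<sigma>: "\<And>t. realised n F L t (\<sigma> t)" by metis
  have zero: "nthc L 0 = 0" using L(1) unfolding valid_config_def by blast
  have K2: "2 * (F 0 + 3) = K" by (simp add: K_def)
  show False
  \<comment> \<open>Since entry 0 of \<open>L\<close> is 0, the value at position 0 is
    \<open>F 0\<close>, and \<open>F 0 + 3\<close> pairs are just enough for the counting
    bound.\<close>
  proof (rule no_merging_sequence[of "\<lambda>p. F (nthc L p)" "F 0 + 3" n \<sigma>])
    show "atoms n (F (nthc L p)) \<inter> atoms n (F (nthc L q)) \<subseteq> atoms n (F (nthc L 1))"
      if "2 \<le> p" "p < q" "q < 2 * (F 0 + 3)" for p q
      using L(1) that atoms_le unfolding valid_config_def K2 K_def by (auto simp: less_Suc_eq_le)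
    show "(F (nthc L p), F (nthc L q)) \<in> H_jump_stage n (\<sigma> t) \<longleftrightarrow> merged t p q"
      if "p < 2 * (F 0 + 3)" "q < 2 * (F 0 + 3)" for t p q
      using \<sigma>[of t] that unfolding realised_def K2 K_def[symmetric] by blast
  qed (simp add: zero)
qed

theorem theorem7p8:
  fixes n :: nat
  shows "\<not> universal ((sat_jump ^^ n) H_rel)"
  using diag_rel_not_reducible equiv_diag_rel ce2_diag_rel unfolding universal_def ceer_def by blast

end
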